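(* Let $\rho_1,\dots,\rho_K\in\mathcal{D}(\mathcal{H}_A)$ and $\sigma_{AB}\in\mathcal{D}(\mathcal{H}_A\otimes\mathcal{H}_B)$ be unknown states, let $c_1,\dots,c_K\in\mathbb{R}$, $c:=\sum_{j}|c_j|$, and $H:=\sum_{j=1}^Kc_j\rho_j$. For $t\in\mathbb{R}$ and $\delta>0$ there is a protocol using $n=O(c^2t^2/\delta)$ samples from the states $\{\rho_1,\dots,\rho_K\}$ that transforms $\sigma_{AB}$ into $\tilde\sigma_{AB}$ with $$\tfrac12\big\|(e^{-iHt}\otimes\mathbb{1}_B)\sigma_{AB}(e^{iHt}\otimes\mathbb{1}_B)-\tilde\sigma_{AB}\big\|_1\le O(\delta).$$ Moreover, the expected number of copies of $\rho_j$ consumed is $O(|c_j|\,c\,t^2/\delta)$.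
   Context: $\mathcal{D}(\mathcal{H})$ denotes the set of density operators on $\mathcal{H}$; $\|A\|_1=\operatorname{Tr}\sqrt{AA^\dagger}$. The protocol is fixed independently of the unknown states (it may depend on the known $c_j$, $t$, $\delta$).
   Formalization: The sample count is bounded by ⌈C c²t²/δ⌉ and the expected copies of ρ_j by C(|c_j|c t²/δ + |c_j|/c), since without rounding up to one sample the bound fails when c²t² ≪ δ ≪ c|t|; the Hilbert spaces are taken finite-dimensional. *)

theory Defs
  imports Complex_Main "Jordan_Normal_Form.Matrix"
begin

definition mtrace :: "complex mat \<Rightarrow> complex" where
  "mtrace A = (\<Sum>i<dim_row A. A $$ (i, i))"

definition adj :: "complex mat \<Rightarrow> complex mat" where
  "adj A = mat (dim_col A) (dim_row A) (\<lambda>(i, j). cnj (A $$ (j, i)))"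

definition psd :: "complex mat \<Rightarrow> bool" where
  "psd A \<longleftrightarrow> A \<in> carrier_mat (dim_row A) (dim_row A) \<and>
     (\<forall>v \<in> carrier_vec (dim_row A).
        let z = (\<Sum>i<dim_row A. \<Sum>j<dim_row A. cnj (v $ i) * A $$ (i, j) * v $ j)
        in Im z = 0 \<and> Re z \<ge> 0)"

definition density :: "nat \<Rightarrow> complex mat \<Rightarrow> bool" where
  "density d \<rho> \<longleftrightarrow> \<rho> \<in> carrier_mat d d \<and> psd \<rho> \<and> mtrace \<rho> = 1"

definition msqrt :: "complex mat \<Rightarrow> complex mat" where
  "msqrt P = (THE Q. psd Q \<and> Q * Q = P)"

definition trace_norm :: "complex mat \<Rightarrow> real" where
  "trace_norm A = Re (mtrace (msqrt (A * adj A)))"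

definition kron :: "complex mat \<Rightarrow> complex mat \<Rightarrow> complex mat" where
  "kron A B = mat (dim_row A * dim_row B) (dim_col A * dim_col B)
     (\<lambda>(i, j). A $$ (i div dim_row B, j div dim_col B) * B $$ (i mod dim_row B, j mod dim_col B))"

fun kron_list :: "complex mat list \<Rightarrow> complex mat" where
  "kron_list [] = 1\<^sub>m 1"
| "kron_list (A # As) = kron A (kron_list As)"

definition mexp :: "complex mat \<Rightarrow> complex mat" where
  "mexp A = mat (dim_row A) (dim_row A)
     (\<lambda>(i, j). \<Sum>k. (A ^\<^sub>m k) $$ (i, j) / of_nat (fact k))"

(* quantum channel C^din -> C^dout given in Kraus form *)
definition is_channel :: "nat \<Rightarrow> nat \<Rightarrow> complex mat list \<Rightarrow> bool" where
  "is_channel din dout Ks \<longleftrightarrow> (\<forall>K \<in> set Ks. K \<in> carrier_mat dout din) \<and>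
     foldr (\<lambda>K M. adj K * K + M) Ks (0\<^sub>m din din) = 1\<^sub>m din"

definition apply_channel :: "nat \<Rightarrow> complex mat list \<Rightarrow> complex mat \<Rightarrow> complex mat" where
  "apply_channel dout Ks X = foldr (\<lambda>K M. K * X * adj K + M) Ks (0\<^sub>m dout dout)"

definition ham :: "nat \<Rightarrow> nat \<Rightarrow> (nat \<Rightarrow> real) \<Rightarrow> (nat \<Rightarrow> complex mat) \<Rightarrow> complex mat" where
  "ham dA K c \<rho> = mat dA dA (\<lambda>(i, k). \<Sum>j<K. complex_of_real (c j) * \<rho> j $$ (i, k))"

(* A protocol: with probability p js (js in the finite set S of sample sequences),
   consume one copy of rho_j for each entry j of js and apply the channel Phi js
   to sigma_AB (x) rho_{js!0} (x) ... (x) rho_{js!(m-1)}, producing a state on A(x)B. *)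
definition protocol_output ::
  "nat \<Rightarrow> nat \<Rightarrow> nat list set \<Rightarrow> (nat list \<Rightarrow> real) \<Rightarrow> (nat list \<Rightarrow> complex mat list)
    \<Rightarrow> (nat \<Rightarrow> complex mat) \<Rightarrow> complex mat \<Rightarrow> complex mat" where
  "protocol_output dA dB S p \<Phi> \<rho> \<sigma> = mat (dA * dB) (dA * dB) (\<lambda>(i, k).
     \<Sum>js\<in>S. complex_of_real (p js) *
        apply_channel (dA * dB) (\<Phi> js) (kron \<sigma> (kron_list (map \<rho> js))) $$ (i, k))"

definition valid_protocol ::
  "nat \<Rightarrow> nat \<Rightarrow> nat \<Rightarrow> nat list set \<Rightarrow> (nat list \<Rightarrow> real) \<Rightarrow> (nat list \<Rightarrow> complex mat list) \<Rightarrow> bool" where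
  "valid_protocol dA dB K S p \<Phi> \<longleftrightarrow> finite S \<and> (\<forall>js \<in> S. p js \<ge> 0) \<and> (\<Sum>js\<in>S. p js) = 1 \<and>
     (\<forall>js \<in> S. set js \<subseteq> {..<K} \<and> is_channel (dA * dB * dA ^ length js) (dA * dB) (\<Phi> js))"

end

theory Submission
  imports Defs "Jordan_Normal_Form.Spectral_Radius"
begin

text \<open>Write \<open>y = c |t|\<close> and \<open>x = y / n\<close>. In each of \<open>n\<close> rounds an index \<open>j\<close> is drawn with probability
  \<open>|c\<^sub>j| / c\<close> and the system \<open>A\<close> interacts with a fresh copy of \<open>\<rho>\<^sub>j\<close> through \<open>exp (\<mp> \<i> \<theta> SWAP)\<close>, the
  sign being that of \<open>c\<^sub>j t\<close>, after which the copy is discarded. On average one round maps \<open>X\<close> to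
  \<open>cos\<^sup>2 \<theta> X + sin\<^sup>2 \<theta> T - \<i> [G, X]\<close> with \<open>T\<close> a state and, if \<open>sin \<theta> cos \<theta> = x\<close>, with \<open>G = t H / n\<close>. Since
  \<open>sin\<^sup>2 \<theta> \<le> 2 x\<^sup>2\<close>, this agrees with \<open>exp (- \<i> G) X exp (\<i> G)\<close> up to \<open>8 x\<^sup>2\<close> in trace norm. Both maps are
  trace-norm contractions, so the errors add up to \<open>8 n x\<^sup>2 = 8 y\<^sup>2 / n\<close>, and \<open>n \<ge> 4 y\<^sup>2 / \<delta>\<close> suffices.
  For \<open>\<delta> \<ge> 1\<close> nothing has to be done.\<close>

section \<open>Adjoints and unitary matrices\<close>

declare index_mult_mat(1) [simp del] assoc_mult_mat [simp del]

lemma index_mult_mat_sum: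
  "i < dim_row A \<Longrightarrow> j < dim_col B \<Longrightarrow> dim_col A = dim_row B \<Longrightarrow>
    (A * B) $$ (i, j) = (\<Sum>l<dim_row B. A $$ (i, l) * B $$ (l, j))"
  by (simp add: index_mult_mat(1) scalar_prod_def lessThan_atLeast0)

text \<open>Variants of the library's ring laws whose premises mention dimensions only, so that the
  simplifier can discharge them for compound matrices.\<close>

lemma mult_mat_assoc:
  fixes A B C :: "'a::semiring_1 mat"
  shows "dim_col A = dim_row B \<Longrightarrow> dim_col B = dim_row C \<Longrightarrow> A * B * C = A * (B * C)"
  by (rule assoc_mult_mat[of _ "dim_row A" "dim_row B" _ "dim_row C"]) auto

lemma mat_mult_distribs:
  fixes A B C :: "'a::comm_ring_1 mat"
  shows add_mult_mat: "dim_row A = dim_row B \<Longrightarrow> dim_col A = dim_row C \<Longrightarrow> dim_col B = dim_row C \<Longrightarrow>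
      (A + B) * C = A * C + B * C"
    and diff_mult_mat: "dim_row A = dim_row B \<Longrightarrow> dim_col A = dim_row C \<Longrightarrow> dim_col B = dim_row C \<Longrightarrow>
      (A - B) * C = A * C - B * C"
    and mult_add_mat: "dim_col C = dim_row A \<Longrightarrow> dim_row A = dim_row B \<Longrightarrow> dim_col A = dim_col B \<Longrightarrow>
      C * (A + B) = C * A + C * B"
    and mult_diff_mat: "dim_col C = dim_row A \<Longrightarrow> dim_row A = dim_row B \<Longrightarrow> dim_col A = dim_col B \<Longrightarrow>
      C * (A - B) = C * A - C * B"
    and smult_add_mat: "dim_row A = dim_row B \<Longrightarrow> dim_col A = dim_col B \<Longrightarrow> a \<cdot>\<^sub>m (A + B) = a \<cdot>\<^sub>m A + a \<cdot>\<^sub>m B"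
    and smult_mult_mat: "dim_col A = dim_row C \<Longrightarrow> (a \<cdot>\<^sub>m A) * C = a \<cdot>\<^sub>m (A * C)"
    and mult_smult_mat: "dim_col C = dim_row A \<Longrightarrow> C * (a \<cdot>\<^sub>m A) = a \<cdot>\<^sub>m (C * A)"
  by (auto intro!: eq_matI simp: index_mult_mat_sum distrib_left distrib_right
    left_diff_distrib right_diff_distrib
      sum.distrib sum_subtractf sum_distrib_left mult.assoc mult.left_commute)

lemma smult_smult_mat: "a \<cdot>\<^sub>m (b \<cdot>\<^sub>m A) = (a * b) \<cdot>\<^sub>m A" for A :: "'a::semigroup_mult mat"
  by (rule eq_matI) (auto simp: mult.assoc)

lemma dim_adj [simp]: "dim_row (adj A) = dim_col A" "dim_col (adj A) = dim_row A"
  by (simp_all add: adj_def)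

lemma adj_index [simp]: "i < dim_col A \<Longrightarrow> j < dim_row A \<Longrightarrow> adj A $$ (i, j) = cnj (A $$ (j, i))"
  by (simp add: adj_def)

lemma adj_carrier [simp]: "A \<in> carrier_mat n m \<Longrightarrow> adj A \<in> carrier_mat m n"
  by auto

lemma adj_adj [simp]: "adj (adj A) = A"
  by (rule eq_matI) auto

lemma adj_one [simp]: "adj (1\<^sub>m n) = 1\<^sub>m n"
  by (rule eq_matI) auto

lemma adj_mult: "dim_col A = dim_row B \<Longrightarrow> adj (A * B) = adj B * adj A"
  by (auto simp: index_mult_mat_sum cnj_sum mult.commute intro!: eq_matI)

lemma adj_linear:
  "dim_row A = dim_row B \<Longrightarrow> dim_col A = dim_col B \<Longrightarrow> adj (A + B) = adj A + adj B"
  "dim_row A = dim_row B \<Longrightarrow> dim_col A = dim_col B \<Longrightarrow> adj (A - B) = adj A - adj B"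
  "adj (a \<cdot>\<^sub>m A) = cnj a \<cdot>\<^sub>m adj A"
  by (auto intro!: eq_matI)

lemma conj_index:
  assumes "A \<in> carrier_mat n n" "B \<in> carrier_mat m n" "i < m" "j < m"
  shows "(B * A * adj B) $$ (i, j) = (\<Sum>k<n. \<Sum>l<n. B $$ (i, k) * A $$ (k, l) * cnj (B $$ (j, l)))"
proof -
  have "(B * A * adj B) $$ (i, j) = (\<Sum>l<n. \<Sum>k<n. B $$ (i, k) * A $$ (k, l) * cnj (B $$ (j, l)))"
    using assms by (simp add: index_mult_mat_sum sum_distrib_right)
  also have "\<dots> = (\<Sum>k<n. \<Sum>l<n. B $$ (i, k) * A $$ (k, l) * cnj (B $$ (j, l)))"
    by (rule sum.swap)
  finally show ?thesis .
qed

definition unitary :: "nat \<Rightarrow> complex mat \<Rightarrow> bool" where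
  "unitary n V \<longleftrightarrow> V \<in> carrier_mat n n \<and> adj V * V = 1\<^sub>m n \<and> V * adj V = 1\<^sub>m n"

lemma unitaryI: "V \<in> carrier_mat n n \<Longrightarrow> adj V * V = 1\<^sub>m n \<Longrightarrow> unitary n V"
  using mat_mult_left_right_inverse[of "adj V" n V] by (auto simp: unitary_def)

lemma unitary_carrier: "unitary n V \<Longrightarrow> V \<in> carrier_mat n n"
  by (simp add: unitary_def)

lemma unitary_inverse: "unitary n V \<Longrightarrow> adj V * V = 1\<^sub>m n" "unitary n V \<Longrightarrow> V * adj V = 1\<^sub>m n"
  by (simp_all add: unitary_def)

lemma unitary_adj: "unitary n V \<Longrightarrow> unitary n (adj V)"
  by (auto simp: unitary_def)

lemma unitary_one: "unitary n (1\<^sub>m n)"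
  by (simp add: unitary_def)

lemma unitary_cancel:
  assumes "unitary n V" "dim_row X = n"
  shows "adj V * (V * X) = X" "V * (adj V * X) = X"
  using assms(2) unitary_carrier[OF assms(1)] unitary_inverse[OF assms(1)]
  by (simp_all flip: mult_mat_assoc)

lemma unitary_mult:
  assumes "unitary n V" "unitary n W"
  shows "unitary n (V * W)"
proof (rule unitaryI)
  show "adj (V * W) * (V * W) = 1\<^sub>m n"
    using assms[THEN unitary_carrier]
    by (simp add: adj_mult mult_mat_assoc unitary_cancel[OF assms(1)] unitary_inverse[OF assms(2)])
qed (use assms[THEN unitary_carrier] in auto)

section \<open>The spectral theorem\<close>

lemma dim_mat_diag [simp]: "dim_row (mat_diag n f) = n" "dim_col (mat_diag n f) = n"
  by (simp_all add: mat_diag_def)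

lemma adj_mat_diag: "adj (mat_diag n f) = mat_diag n (\<lambda>i. cnj (f i))"
  by (rule eq_matI) (auto simp: mat_diag_def)

lemma index_mult_mat_diag:
  "i < dim_row A \<Longrightarrow> j < dim_col A \<Longrightarrow> (A * mat_diag (dim_col A) f) $$ (i, j) = A $$ (i, j) * f j"
  by (subst mat_diag_mult_right[of A "dim_row A"]) auto

lemma index_mat_diag_mult:
  "i < dim_row A \<Longrightarrow> j < dim_col A \<Longrightarrow> (mat_diag (dim_row A) f * A) $$ (i, j) = f i * A $$ (i, j)"
  by (subst mat_diag_mult_left[of A _ "dim_col A"]) auto

definition spectral_mat :: "complex mat \<Rightarrow> (nat \<Rightarrow> complex) \<Rightarrow> complex mat" where
  "spectral_mat V f = V * mat_diag (dim_col V) f * adj V"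

lemma dim_spectral_mat [simp]:
  "dim_row (spectral_mat V f) = dim_row V" "dim_col (spectral_mat V f) = dim_row V"
  by (simp_all add: spectral_mat_def)

lemma spectral_mat_index:
  "i < dim_row V \<Longrightarrow> j < dim_row V \<Longrightarrow>
    spectral_mat V f $$ (i, j) = (\<Sum>l<dim_col V. V $$ (i, l) * f l * cnj (V $$ (j, l)))"
  by (simp add: spectral_mat_def index_mult_mat_sum[of _ "V * mat_diag (dim_col V) f"]
    index_mult_mat_diag)

lemma adj_mult_self_index:
  assumes "i < dim_col A" "j < dim_col A"
  shows "(adj A * A) $$ (i, j) = col A j \<bullet>c col A i"
  using assms
  by (auto simp: index_mult_mat_sum scalar_prod_def lessThan_atLeast0 mult.commute intro!: sum.cong)

lemma corthogonal_mat_col_norm_pos: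
  fixes A :: "complex mat"
  assumes "corthogonal_mat A" "j < dim_col A"
  shows "0 < Re (col A j \<bullet>c col A j)" "col A j \<bullet>c col A j = of_real (Re (col A j \<bullet>c col A j))"
proof -
  have "0 \<le> col A j \<bullet>c col A j" "col A j \<bullet>c col A j \<noteq> 0"
    using corthogonal_matD[OF assms(1), of j j] assms(2) by auto
  then show "0 < Re (col A j \<bullet>c col A j)" "col A j \<bullet>c col A j = of_real (Re (col A j \<bullet>c col A j))"
    by (auto simp: less_eq_complex_def complex_eq_iff)
qed

lemma corthogonal_mat_normalize:
  fixes A :: "complex mat"
  assumes A: "A \<in> carrier_mat n n" and orth: "corthogonal_mat A"
  obtains f where "\<And>i. i < n \<Longrightarrow> f i \<noteq> 0" "unitary n (A * mat_diag n f)"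
proof -
  define r where "r j = Re (col A j \<bullet>c col A j)" for j
  define f where "f j = complex_of_real (1 / sqrt (r j))" for j
  have r: "r j > 0" "col A j \<bullet>c col A j = of_real (r j)" if "j < n" for j
    using corthogonal_mat_col_norm_pos[OF orth, of j] that A by (simp_all add: r_def)
  have "adj (A * mat_diag n f) * (A * mat_diag n f) = 1\<^sub>m n"
  proof (rule eq_matI)
    fix i j assume "i < dim_row (1\<^sub>m n :: complex mat)" "j < dim_col (1\<^sub>m n :: complex mat)"
    then have ij: "i < n" "j < n" by auto
    have "(adj (A * mat_diag n f) * (A * mat_diag n f)) $$ (i, j) =
      cnj (f i) * f j * (adj A * A) $$ (i, j)"
      using A ij index_mult_mat_diag[of _ A _ f]
      by (simp add: index_mult_mat_sum[of _ "adj _"] sum_distrib_left mult_ac)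
    also have "\<dots> = cnj (f i) * f j * (col A j \<bullet>c col A i)"
      using A ij by (simp add: adj_mult_self_index)
    also have "\<dots> = 1\<^sub>m n $$ (i, j)"
    proof (cases "i = j")
      case True
      have "cnj (f j) * f j * of_real (r j) = of_real (1 / sqrt (r j) * (1 / sqrt (r j)) * r j)"
        by (simp only: f_def complex_cnj_complex_of_real of_real_mult)
      then show ?thesis
        using True ij r[OF ij(2)] by simp
    next
      case False
      then show ?thesis
        using corthogonal_matD[OF orth, of j i] A ij by simp
    qed
    finally show "(adj (A * mat_diag n f) * (A * mat_diag n f)) $$ (i, j) = 1\<^sub>m n $$ (i, j)" .
  qed (use A in auto)
  then have "unitary n (A * mat_diag n f)"
    using A by (intro unitaryI) auto
  moreover have "f i \<noteq> 0" if "i < n" for i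
    using r(1)[OF that] by (simp add: f_def)
  ultimately show thesis
    using that by blast
qed

lemma unitary_with_first_col:
  fixes v :: "complex vec"
  assumes v: "v \<in> carrier_vec n" "v \<noteq> 0\<^sub>v n"
  obtains W a where "unitary n W" "v = a \<cdot>\<^sub>v col W 0"
proof -
  interpret cof_vec_space n "TYPE(complex)" .
  define ws where "ws = gram_schmidt n (basis_completion v)"
  have n: "n > 0"
    using v by (cases n) auto
  have bv: "hd (basis_completion v) = v" "basis_completion v \<noteq> []"
    using basis_completion[OF v] n by auto
  have ws: "set ws \<subseteq> carrier_vec n" "corthogonal ws" "length ws = n"
    using gram_schmidt_result[OF _ _ _ ws_def] basis_completion[OF v] by auto
  have "hd ws = v"
    using gram_schmidt_hd[OF v(1), of "tl (basis_completion v)"] bv by (metis ws_def list.collapse)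
  then have ws0: "ws ! 0 = v"
    using ws n by (cases ws) auto
  define A where "A = mat_of_cols n ws"
  have A: "A \<in> carrier_mat n n"
    using mat_of_cols_carrier(1)[of n ws] ws(3) by (simp add: A_def)
  obtain f where f: "f 0 \<noteq> 0" "unitary n (A * mat_diag n f)"
    using corthogonal_mat_normalize[OF A] orthogonal_mat_of_cols[OF ws] n unfolding A_def by metis
  have "col A 0 = v"
    using ws ws0 n v(1) by (simp add: A_def col_mat_of_cols)
  then have "col (A * mat_diag n f) 0 = f 0 \<cdot>\<^sub>v v"
    using A n index_mult_mat_diag[of _ A 0 f] by (intro eq_vecI) (auto simp: mult.commute)
  then have "v = (1 / f 0) \<cdot>\<^sub>v col (A * mat_diag n f) 0"
    using f(1) by (auto simp: smult_smult_assoc)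
  then show thesis
    using that f(2) by blast
qed

definition direct_sum :: "complex mat \<Rightarrow> complex mat \<Rightarrow> complex mat" where
  "direct_sum A D = four_block_mat A (0\<^sub>m (dim_row A) (dim_col D)) (0\<^sub>m (dim_row D) (dim_col A)) D"

lemma dim_direct_sum [simp]:
  "dim_row (direct_sum A D) = dim_row A + dim_row D" "dim_col (direct_sum A D) = dim_col A + dim_col D"
  by (simp_all add: direct_sum_def)

lemma direct_sum_mult:
  assumes "dim_col A = dim_row A'" "dim_col D = dim_row D'"
  shows "direct_sum A D * direct_sum A' D' = direct_sum (A * A') (D * D')"
  unfolding direct_sum_def using assms
  by (subst mult_four_block_mat[where ?nr1.0 = "dim_row A" and ?nr2.0 = "dim_row D"
      and ?n1.0 = "dim_col A" and ?n2.0 = "dim_col D" and ?nc1.0 = "dim_col A'"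
      and ?nc2.0 = "dim_col D'"]) auto

lemma adj_direct_sum: "adj (direct_sum A D) = direct_sum (adj A) (adj D)"
  by (rule eq_matI) (auto simp: direct_sum_def)

lemma unitary_direct_sum:
  assumes "unitary n V" "unitary m W"
  shows "unitary (n + m) (direct_sum V W)"
proof (rule unitaryI)
  show "adj (direct_sum V W) * direct_sum V W = 1\<^sub>m (n + m)"
    using assms by (auto simp: unitary_def adj_direct_sum direct_sum_mult) (simp add: direct_sum_def)
qed (use assms[THEN unitary_carrier] in auto)

lemma direct_sum_mat_diag:
  "direct_sum (mat_diag n f) (mat_diag m g) = mat_diag (n + m) (\<lambda>i. if i < n then f i else g (i - n))"
  by (rule eq_matI) (auto simp: direct_sum_def mat_diag_def)

lemma direct_sum_spectral_mat:
  "direct_sum (spectral_mat V f) (spectral_mat W g) =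
    spectral_mat (direct_sum V W) (\<lambda>i. if i < dim_col V then f i else g (i - dim_col V))"
  by (simp add: spectral_mat_def direct_sum_mult adj_direct_sum flip: direct_sum_mat_diag)

lemma unitary_with_first_col_eigenvector:
  assumes A: "A \<in> carrier_mat n n" and n: "n > 0"
  obtains W e where "unitary n W" "A *\<^sub>v col W 0 = e \<cdot>\<^sub>v col W 0"
proof -
  obtain e v where v: "v \<in> carrier_vec n" "v \<noteq> 0\<^sub>v n" "A *\<^sub>v v = e \<cdot>\<^sub>v v"
    using spectrum_non_empty[of A n] A n by (auto simp: spectrum_def eigenvalue_def eigenvector_def)
  obtain W a where W: "unitary n W" and va: "v = a \<cdot>\<^sub>v col W 0"
    using unitary_with_first_col[OF v(1,2)] by blast
  note Wc = unitary_carrier[OF W]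
  have a: "a \<noteq> 0"
    using v(1,2) va Wc by (auto simp: eq_vecI)
  have "A *\<^sub>v col W 0 = e \<cdot>\<^sub>v col W 0"
  proof (rule eq_vecI)
    fix k assume "k < dim_vec (e \<cdot>\<^sub>v col W 0)"
    then have k: "k < n" using Wc by simp
    have "A *\<^sub>v v = a \<cdot>\<^sub>v (A *\<^sub>v col W 0)"
      unfolding va using Wc by (intro mult_mat_vec[OF A] carrier_vecI) simp
    then have "a * (A *\<^sub>v col W 0) $ k = a * (e * col W 0 $ k)"
      using arg_cong[OF v(3), of "\<lambda>u. u $ k"] A Wc va k by simp
    then show "(A *\<^sub>v col W 0) $ k = (e \<cdot>\<^sub>v col W 0) $ k"
      using a k Wc by simp
  qed (use A Wc in auto)
  with W that show thesis by blast
qed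

lemma hermitian_deflation:
  assumes A: "A \<in> carrier_mat (Suc m) (Suc m)" and herm: "adj A = A"
  obtains W B and e :: real where "unitary (Suc m) W" "B \<in> carrier_mat m m" "adj B = B"
    "A = W * direct_sum (spectral_mat (1\<^sub>m 1) (\<lambda>_. of_real e)) B * adj W"
proof -
  let ?n = "Suc m"
  obtain W e where W: "unitary ?n W" and eig: "A *\<^sub>v col W 0 = e \<cdot>\<^sub>v col W 0"
    using unitary_with_first_col_eigenvector[OF A] by blast
  note Wc = unitary_carrier[OF W]
  define M where "M = adj W * A * W"
  have M: "M \<in> carrier_mat ?n ?n" and M_herm: "adj M = M"
    using A Wc herm by (auto simp: M_def adj_mult mult_mat_assoc)
  have M_col: "M $$ (i, 0) = (if i = 0 then e else 0)" if "i < ?n" for i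
  proof -
    have "(A * W) $$ (k, 0) = e * W $$ (k, 0)" if "k < ?n" for k
      using arg_cong[OF eig, of "\<lambda>u. u $ k"] A Wc that by (simp add: index_mult_mat(1))
    then have "M $$ (i, 0) = e * (adj W * W) $$ (i, 0)"
      using A Wc that
      by (simp add: M_def mult_mat_assoc index_mult_mat_sum[of _ "adj W"] sum_distrib_left mult_ac
          del: sum.lessThan_Suc)
    then show ?thesis
      using that by (simp add: unitary_inverse[OF W])
  qed
  have M_row: "M $$ (0, j) = cnj (M $$ (j, 0))" if "j < ?n" for j
    using M_herm M that by (metis adj_index carrier_matD zero_less_Suc)
  obtain x where e: "e = of_real x"
    using M_row[of 0] M_col[of 0] by (metis Reals_cases Reals_cnj_iff zero_less_Suc)
  define B where "B = mat m m (\<lambda>(i, j). M $$ (Suc i, Suc j))"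
  have B: "B \<in> carrier_mat m m" "adj B = B"
    unfolding B_def using M_herm M by (auto intro!: eq_matI, metis Suc_less_eq adj_index carrier_matD)
  have M_block: "M = direct_sum (spectral_mat (1\<^sub>m 1) (\<lambda>_. of_real x)) B"
    using M M_col M_row e
    by (intro eq_matI) (auto simp: B_def direct_sum_def spectral_mat_def mat_diag_def)
  have "A = W * M * adj W"
    using A Wc by (simp add: M_def mult_mat_assoc unitary_inverse[OF W] unitary_cancel[OF W])
  then show thesis
    unfolding M_block by (rule that[OF W B])
qed

theorem hermitian_spectral:
  assumes "A \<in> carrier_mat n n" "adj A = A"
  obtains V and l :: "nat \<Rightarrow> real" where "unitary n V" "A = spectral_mat V (\<lambda>i. of_real (l i))"
  using assms
proof (induction n arbitrary: A thesis)
  case 0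
  have "A = spectral_mat (1\<^sub>m 0) (\<lambda>i. of_real 0)"
    using 0 by (intro eq_matI) auto
  then show ?case
    by (rule 0(1)[OF unitary_one])
next
  case (Suc m)
  obtain W B and e :: real where W: "unitary (Suc m) W" and B: "B \<in> carrier_mat m m" "adj B = B"
    and A: "A = W * direct_sum (spectral_mat (1\<^sub>m 1) (\<lambda>_. of_real e)) B * adj W"
    using hermitian_deflation[OF Suc.prems(2,3)] .
  obtain V and l :: "nat \<Rightarrow> real" where V: "unitary m V" and Bl: "B = spectral_mat V (\<lambda>i. of_real (l i))"
    using Suc.IH[OF _ B] by blast
  let ?V = "direct_sum (1\<^sub>m 1) V" and ?l = "\<lambda>i. if i < 1 then e else l (i - 1)"
  have V': "unitary (Suc m) ?V"
    using unitary_direct_sum[OF unitary_one[of 1] V] by simp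
  have "A = W * spectral_mat ?V (\<lambda>i. of_real (?l i)) * adj W"
    unfolding A Bl direct_sum_spectral_mat by (simp only: index_one_mat if_distrib[of of_real])
  also have "\<dots> = spectral_mat (W * ?V) (\<lambda>i. of_real (?l i))"
    using unitary_carrier[OF W] unitary_carrier[OF V]
    by (simp add: spectral_mat_def adj_mult mult_mat_assoc)
  finally show ?case
    by (rule Suc.prems(1)[OF unitary_mult[OF W V']])
qed

section \<open>Positive semidefinite matrices\<close>

lemma mtrace_carrier: "A \<in> carrier_mat n n \<Longrightarrow> mtrace A = (\<Sum>i<n. A $$ (i, i))"
  by (auto simp: mtrace_def)

lemma mtrace_zero [simp]: "mtrace (0\<^sub>m n n) = 0"
  by (simp add: mtrace_def)

lemma mtrace_add:
  "dim_row A = dim_row B \<Longrightarrow> dim_col B = dim_row B \<Longrightarrow> mtrace (A + B) = mtrace A + mtrace B"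
  by (simp add: mtrace_def sum.distrib)

lemma mtrace_smult: "dim_col A = dim_row A \<Longrightarrow> mtrace (a \<cdot>\<^sub>m A) = a * mtrace A"
  by (simp add: mtrace_def sum_distrib_left)

lemma mtrace_mult_comm:
  assumes "A \<in> carrier_mat n m" "B \<in> carrier_mat m n"
  shows "mtrace (A * B) = mtrace (B * A)"
proof -
  have "mtrace (A * B) = (\<Sum>i<n. \<Sum>l<m. A $$ (i, l) * B $$ (l, i))"
    using assms by (simp add: mtrace_def index_mult_mat_sum)
  also have "\<dots> = (\<Sum>l<m. \<Sum>i<n. A $$ (i, l) * B $$ (l, i))"
    by (rule sum.swap)
  also have "\<dots> = mtrace (B * A)"
    using assms by (simp add: mtrace_def index_mult_mat_sum mult.commute)
  finally show ?thesis .
qed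

lemma mtrace_unitary_conj:
  assumes "unitary n V" "A \<in> carrier_mat n n"
  shows "mtrace (V * A * adj V) = mtrace A"
  using assms(2) unitary_carrier[OF assms(1)] mtrace_mult_comm[of "V * A" n n "adj V"]
  by (simp add: unitary_cancel[OF assms(1)])

text \<open>In the order on \<open>complex\<close>, \<open>0 \<le> z\<close> says that \<open>z\<close> is real and nonnegative. The row \<open>B\<close> stands for
  the bra of the vector in the definition of \<^const>\<open>psd\<close>.\<close>

lemma psd_iff_conj_row_nonneg:
  assumes A: "A \<in> carrier_mat n n"
  shows "psd A \<longleftrightarrow> (\<forall>B \<in> carrier_mat 1 n. 0 \<le> (B * A * adj B) $$ (0, 0))"
proof -
  let ?q = "\<lambda>v. \<Sum>i<n. \<Sum>j<n. cnj (v $ i) * A $$ (i, j) * v $ j"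
  have "psd A \<longleftrightarrow> (\<forall>v \<in> carrier_vec n. 0 \<le> ?q v)"
    using A by (auto simp: psd_def Let_def less_eq_complex_def)
  also have "\<dots> \<longleftrightarrow> (\<forall>B \<in> carrier_mat 1 n. 0 \<le> (B * A * adj B) $$ (0, 0))"
  proof (intro iffI ballI)
    fix B :: "complex mat" assume nonneg: "\<forall>v \<in> carrier_vec n. 0 \<le> ?q v" and B: "B \<in> carrier_mat 1 n"
    have "(B * A * adj B) $$ (0, 0) = ?q (vec n (\<lambda>i. cnj (B $$ (0, i))))"
      using conj_index[OF A B, of 0 0] by simp
    then show "0 \<le> (B * A * adj B) $$ (0, 0)"
      using nonneg by (simp only: vec_carrier)
  next
    fix v assume nonneg: "\<forall>B \<in> carrier_mat 1 n. 0 \<le> (B * A * adj B) $$ (0, 0)"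
    define B where "B = mat 1 n (\<lambda>(_, i). cnj (v $ i))"
    have "(B * A * adj B) $$ (0, 0) = ?q v"
      using conj_index[OF A, of B 1 0 0] by (simp add: B_def)
    then show "0 \<le> ?q v"
      using bspec[OF nonneg, of B] by (simp add: B_def)
  qed
  finally show ?thesis .
qed

lemma psd_conj:
  assumes "psd A" "A \<in> carrier_mat n n" "B \<in> carrier_mat m n"
  shows "psd (B * A * adj B)"
proof -
  have "0 \<le> (C * (B * A * adj B) * adj C) $$ (0, 0)" if "C \<in> carrier_mat 1 m" for C
  proof -
    have "C * (B * A * adj B) * adj C = (C * B) * A * adj (C * B)"
      using assms that by (simp add: mult_mat_assoc adj_mult)
    moreover have "C * B \<in> carrier_mat 1 n"
      using assms that by auto
    ultimately show ?thesis
      using assms psd_iff_conj_row_nonneg[of A n] by simp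
  qed
  then show ?thesis
    using assms by (subst psd_iff_conj_row_nonneg[of _ m]) auto
qed

lemma psd_add:
  assumes "psd A" "psd B" "A \<in> carrier_mat n n" "B \<in> carrier_mat n n"
  shows "psd (A + B)"
  using assms by (auto simp: psd_iff_conj_row_nonneg[of _ n] mat_mult_distribs)

lemma psd_smult:
  assumes "psd A" "A \<in> carrier_mat n n" "a \<ge> 0"
  shows "psd (a \<cdot>\<^sub>m A)"
  using assms by (auto simp: psd_iff_conj_row_nonneg[of _ n] mat_mult_distribs)

lemma psd_zero [simp]: "psd (0\<^sub>m n n)"
  by (auto simp: psd_iff_conj_row_nonneg[of _ n])

lemma psd_diag_nonneg:
  assumes "psd A" "A \<in> carrier_mat n n" "i < n"
  shows "0 \<le> A $$ (i, i)"
proof -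
  define B :: "complex mat" where "B = mat 1 n (\<lambda>(_, j). if j = i then 1 else 0)"
  have B: "B \<in> carrier_mat 1 n"
    by (simp add: B_def)
  have "(B * A * adj B) $$ (0, 0) = (\<Sum>k<n. \<Sum>l<n. B $$ (0, k) * A $$ (k, l) * cnj (B $$ (0, l)))"
    by (rule conj_index[OF assms(2) B]) simp_all
  also have "\<dots> = (\<Sum>k<n. \<Sum>l<n. if l = i then if k = i then A $$ (k, l) else 0 else 0)"
    by (intro sum.cong refl) (simp add: B_def)
  also have "\<dots> = A $$ (i, i)"
    using assms(3) by simp
  finally show ?thesis
    using assms B by (metis psd_iff_conj_row_nonneg)
qed

lemma psd_hermitian:
  assumes "psd A" "A \<in> carrier_mat n n"
  shows "adj A = A"
proof (rule eq_matI)
  fix i j assume "i < dim_row A" "j < dim_col A"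
  then have ij: "i < n" "j < n" using assms by auto
  have real: "A $$ (i, i) + a * A $$ (j, i) + (A $$ (i, j) * cnj a + a * A $$ (j, j) * cnj a) \<in> \<real>" for a
  proof -
    define B where "B = mat 1 n (\<lambda>(_, k). (if k = i then 1 else 0) + (if k = j then a else 0))"
    have B: "B \<in> carrier_mat 1 n"
      by (simp add: B_def)
    have "(B * A * adj B) $$ (0, 0) = (\<Sum>k<n. \<Sum>l<n. B $$ (0, k) * A $$ (k, l) * cnj (B $$ (0, l)))"
      by (rule conj_index[OF assms(2) B]) simp_all
    also have "\<dots> = (\<Sum>k<n. \<Sum>l<n. (if l = i then if k = i then A $$ (k, l) else 0 else 0)
          + (if l = i then if k = j then a * A $$ (k, l) else 0 else 0)
          + ((if l = j then if k = i then A $$ (k, l) * cnj a else 0 else 0)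
          + (if l = j then if k = j then a * A $$ (k, l) * cnj a else 0 else 0)))"
      by (intro sum.cong refl) (simp add: B_def algebra_simps)
    also have "\<dots> = A $$ (i, i) + a * A $$ (j, i) + (A $$ (i, j) * cnj a + a * A $$ (j, j) * cnj a)"
      using ij by (simp add: sum.distrib)
    finally show ?thesis
      using assms B by (metis psd_iff_conj_row_nonneg nonnegative_complex_is_real)
  qed
  have "A $$ (i, i) \<in> \<real>" "A $$ (j, j) \<in> \<real>"
    using psd_diag_nonneg[OF assms] ij by (simp_all add: nonnegative_complex_is_real)
  moreover from this have "cnj (A $$ (j, i)) = A $$ (i, j)"
    using real[of 1] real[of \<i>] by (auto simp: complex_is_Real_iff complex_eq_iff)
  ultimately show "adj A $$ (i, j) = A $$ (i, j)"
    using assms ij by simp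
qed (use assms in auto)

lemma psd_gram:
  assumes "B \<in> carrier_mat n m"
  shows "psd (B * adj B)"
proof -
  have "0 \<le> (C * (B * adj B) * adj C) $$ (0, 0)" if C: "C \<in> carrier_mat 1 n" for C
  proof -
    have "C * (B * adj B) * adj C = (C * B) * adj (C * B)"
      using assms C by (simp add: mult_mat_assoc adj_mult)
    moreover have "((C * B) * adj (C * B)) $$ (0, 0) =
      (\<Sum>l<m. (C * B) $$ (0, l) * cnj ((C * B) $$ (0, l)))"
      using assms C by (simp add: index_mult_mat_sum[of _ _ _ "adj _"])
    moreover have "0 \<le> z * cnj z" for z
      using conjugate_square_positive[of z] by simp
    ultimately show ?thesis
      by (simp add: sum_nonneg)
  qed
  then show ?thesis
    using assms by (subst psd_iff_conj_row_nonneg[of _ n]) auto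
qed

lemma spectral_mat_mult:
  assumes "unitary n V"
  shows "spectral_mat V f * spectral_mat V g = spectral_mat V (\<lambda>i. f i * g i)"
  using unitary_carrier[OF assms]
  by (simp add: spectral_mat_def mult_mat_assoc unitary_cancel[OF assms] flip: mat_diag_diag)

lemma adj_spectral_mat: "adj (spectral_mat V f) = spectral_mat V (\<lambda>i. cnj (f i))"
  by (simp add: spectral_mat_def adj_mult adj_mat_diag mult_mat_assoc)

lemma unitary_conj_spectral_mat:
  assumes "unitary n V"
  shows "adj V * spectral_mat V f * V = mat_diag n f"
  using unitary_carrier[OF assms]
  by (simp add: spectral_mat_def mult_mat_assoc unitary_cancel[OF assms] unitary_inverse[OF assms])

lemma spectral_mat_cong: "dim_col V = n \<Longrightarrow> (\<And>i. i < n \<Longrightarrow> f i = g i) \<Longrightarrow> spectral_mat V f = spectral_mat V g"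
  by (auto simp: spectral_mat_index intro!: eq_matI sum.cong)

lemma mtrace_spectral_mat:
  assumes "unitary n V"
  shows "mtrace (spectral_mat V f) = (\<Sum>i<n. f i)"
  using mtrace_unitary_conj[OF assms mat_diag_dim, of f] unitary_carrier[OF assms]
  by (simp add: spectral_mat_def mtrace_carrier[OF mat_diag_dim]) (simp add: mat_diag_def)

lemma spectral_mat_eq_gram:
  assumes "unitary n V" "\<And>i. i < n \<Longrightarrow> l i \<ge> (0::real)"
  defines "B \<equiv> spectral_mat V (\<lambda>i. of_real (sqrt (l i)))"
  shows "spectral_mat V (\<lambda>i. of_real (l i)) = B * adj B"
  unfolding B_def adj_spectral_mat spectral_mat_mult[OF assms(1)]
  using unitary_carrier[OF assms(1)] assms(2)
  by (intro spectral_mat_cong[of _ n]) (auto simp flip: of_real_mult)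

lemma psd_spectral_mat:
  assumes "unitary n V" "\<And>i. i < n \<Longrightarrow> l i \<ge> (0::real)"
  shows "psd (spectral_mat V (\<lambda>i. of_real (l i)))"
  using assms unitary_carrier[OF assms(1)]
  by (subst spectral_mat_eq_gram) (auto intro!: psd_gram[of _ n n])

lemma psd_spectral:
  assumes "psd A" "A \<in> carrier_mat n n"
  obtains V and l :: "nat \<Rightarrow> real"
  where "unitary n V" "A = spectral_mat V (\<lambda>i. of_real (l i))" "\<And>i. i < n \<Longrightarrow> l i \<ge> 0"
proof -
  obtain V and l :: "nat \<Rightarrow> real" where V: "unitary n V" and A: "A = spectral_mat V (\<lambda>i. of_real (l i))"
    using hermitian_spectral[OF assms(2) psd_hermitian[OF assms]] .
  have "l i \<ge> 0" if i: "i < n" for i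
  proof -
    have "psd (mat_diag n (\<lambda>i. of_real (l i)))"
      using psd_conj[OF assms, of "adj V" n] unitary_carrier[OF V] unitary_conj_spectral_mat[OF V] A
      by simp
    then show ?thesis
      using psd_diag_nonneg[OF _ mat_diag_dim i] i by (fastforce simp: mat_diag_def less_eq_complex_def)
  qed
  with V A that show thesis by blast
qed

lemma psd_factor:
  assumes "psd A" "A \<in> carrier_mat n n"
  obtains B where "B \<in> carrier_mat n n" "A = B * adj B"
proof -
  obtain V and l :: "nat \<Rightarrow> real"
    where V: "unitary n V" and A: "A = spectral_mat V (\<lambda>i. of_real (l i))" and l: "\<And>i. i < n \<Longrightarrow> l i \<ge> 0"
    using psd_spectral[OF assms] by blast
  have "spectral_mat V (\<lambda>i. of_real (sqrt (l i))) \<in> carrier_mat n n"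
    using unitary_carrier[OF V] by auto
  then show thesis
    using A spectral_mat_eq_gram[OF V l] by (intro that) auto
qed

section \<open>The trace norm\<close>

lemma mat_diag_squares_intertwine:
  fixes a b :: "nat \<Rightarrow> real" and M :: "complex mat"
  assumes M: "M \<in> carrier_mat n m" and a: "\<And>i. i < n \<Longrightarrow> a i \<ge> 0" and b: "\<And>j. j < m \<Longrightarrow> b j \<ge> 0"
    and squares: "mat_diag n (\<lambda>i. of_real ((a i)\<^sup>2)) * M = M * mat_diag m (\<lambda>j. of_real ((b j)\<^sup>2))"
  shows "mat_diag n (\<lambda>i. of_real (a i)) * M = M * mat_diag m (\<lambda>j. of_real (b j))"
proof (rule eq_matI)
  fix i j
  assume "i < dim_row (M * mat_diag m (\<lambda>j. of_real (b j)))"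
    "j < dim_col (M * mat_diag m (\<lambda>j. of_real (b j)))"
  then have ij: "i < n" "j < m" using M by auto
  have "of_real ((a i)\<^sup>2) * M $$ (i, j) = M $$ (i, j) * of_real ((b j)\<^sup>2)"
    using arg_cong[OF squares, of "\<lambda>A. A $$ (i, j)"] ij M
      index_mult_mat_diag[of i M j] index_mat_diag_mult[of i M j] by simp
  then have "(a i)\<^sup>2 = (b j)\<^sup>2 \<or> M $$ (i, j) = 0"
    by (auto simp flip: of_real_power)
  then have "a i = b j \<or> M $$ (i, j) = 0"
    using a b ij by (auto simp: power2_eq_iff_nonneg)
  then show "(mat_diag n (\<lambda>i. of_real (a i)) * M) $$ (i, j) =
    (M * mat_diag m (\<lambda>j. of_real (b j))) $$ (i, j)"
    using ij M index_mult_mat_diag[of i M j] index_mat_diag_mult[of i M j] by auto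
qed (use M in auto)

lemma psd_sqrt_unique:
  assumes P: "psd P" "P \<in> carrier_mat n n" and Q: "psd Q" "Q \<in> carrier_mat n n" and eq: "Q * Q = P * P"
  shows "Q = P"
proof -
  obtain V and a :: "nat \<Rightarrow> real"
    where V: "unitary n V" and QV: "Q = spectral_mat V (\<lambda>i. of_real (a i))" and a: "\<And>i. i < n \<Longrightarrow> a i \<ge> 0"
    using psd_spectral[OF Q] by blast
  obtain W and b :: "nat \<Rightarrow> real"
    where W: "unitary n W" and PW: "P = spectral_mat W (\<lambda>i. of_real (b i))" and b: "\<And>i. i < n \<Longrightarrow> b i \<ge> 0"
    using psd_spectral[OF P] by blast
  note carriers = unitary_carrier[OF V] unitary_carrier[OF W]
  define M where "M = adj V * W"
  have M: "M \<in> carrier_mat n n"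
    using carriers by (auto simp: M_def)
  have left: "adj V * spectral_mat V f * W = mat_diag n f * M" for f
    using carriers by (simp add: spectral_mat_def M_def mult_mat_assoc unitary_cancel[OF V])
  have right: "adj V * spectral_mat W f * W = M * mat_diag n f" for f
    using carriers by (simp add: spectral_mat_def M_def mult_mat_assoc unitary_inverse[OF W])
  have squares: "mat_diag n (\<lambda>i. of_real ((a i)\<^sup>2)) * M = M * mat_diag n (\<lambda>i. of_real ((b i)\<^sup>2))"
    using eq unfolding QV PW spectral_mat_mult[OF V] spectral_mat_mult[OF W]
    by (simp add: power2_eq_square flip: left right)
  have "adj V * Q * W = adj V * P * W"
    unfolding QV PW left right by (rule mat_diag_squares_intertwine[OF M _ _ squares]) (use a b in auto)
  from arg_cong[OF this, of "\<lambda>A. V * A * adj W"] show "Q = P"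
    using carriers P(2) Q(2) by (simp add: mult_mat_assoc unitary_cancel[OF V] unitary_inverse[OF W])
qed

lemma msqrt_eqI:
  assumes "psd Q" "Q \<in> carrier_mat n n" "Q * Q = P"
  shows "msqrt P = Q"
  unfolding msqrt_def
proof (rule the_equality)
  fix R assume R: "psd R \<and> R * R = P"
  have "dim_row R = n"
    using R assms by (metis carrier_matD(1) index_mult_mat(2))
  then have "R \<in> carrier_mat n n"
    using R by (auto simp: psd_def)
  then show "R = Q"
    using R assms(3) by (intro psd_sqrt_unique[OF assms(1,2)]) auto
qed (use assms in simp)

lemma trace_norm_spectral_mat:
  assumes "unitary n V"
  shows "trace_norm (spectral_mat V (\<lambda>i. of_real (l i))) = (\<Sum>i<n. \<bar>l i\<bar>)"
proof -
  let ?D = "spectral_mat V (\<lambda>i. of_real (l i))" and ?S = "spectral_mat V (\<lambda>i. of_real \<bar>l i\<bar>)"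
  have "?S * ?S = ?D * adj ?D"
    by (simp add: spectral_mat_mult[OF assms] adj_spectral_mat flip: of_real_mult)
  then have "msqrt (?D * adj ?D) = ?S"
    using psd_spectral_mat[OF assms, of "\<lambda>i. \<bar>l i\<bar>"] unitary_carrier[OF assms]
    by (intro msqrt_eqI[of _ n]) auto
  then show ?thesis
    by (simp add: trace_norm_def mtrace_spectral_mat[OF assms])
qed

text \<open>An upper bound on the trace norm of a Hermitian matrix is witnessed by any decomposition into
  a difference of positive parts, which makes contractivity under positive trace-preserving maps
  immediate.\<close>

definition trace_bound :: "nat \<Rightarrow> complex mat \<Rightarrow> real \<Rightarrow> bool" where
  "trace_bound n D r \<longleftrightarrow> (\<exists>P Q. P \<in> carrier_mat n n \<and> Q \<in> carrier_mat n n \<and> psd P \<and> psd Q \<and>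
     D = P - Q \<and> Re (mtrace P) + Re (mtrace Q) \<le> r)"

lemma trace_boundI:
  "P \<in> carrier_mat n n \<Longrightarrow> Q \<in> carrier_mat n n \<Longrightarrow> psd P \<Longrightarrow> psd Q \<Longrightarrow> D = P - Q \<Longrightarrow>
   Re (mtrace P) + Re (mtrace Q) \<le> r \<Longrightarrow> trace_bound n D r"
  by (auto simp: trace_bound_def)

lemma trace_boundE:
  assumes "trace_bound n D r"
  obtains P Q where "P \<in> carrier_mat n n" "Q \<in> carrier_mat n n" "psd P" "psd Q" "D = P - Q"
    "Re (mtrace P) + Re (mtrace Q) \<le> r"
  using assms by (auto simp: trace_bound_def)

lemma trace_norm_le:
  assumes "trace_bound n D r"
  shows "trace_norm D \<le> r"
proof -
  obtain P Q where P: "P \<in> carrier_mat n n" "psd P" and Q: "Q \<in> carrier_mat n n" "psd Q"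
    and D: "D = P - Q" and r: "Re (mtrace P) + Re (mtrace Q) \<le> r"
    using assms by (rule trace_boundE)
  have "D \<in> carrier_mat n n" "adj D = D"
    using P Q by (auto simp: D adj_linear psd_hermitian)
  then obtain V and l :: "nat \<Rightarrow> real"
    where V: "unitary n V" and Dl: "D = spectral_mat V (\<lambda>i. of_real (l i))"
    by (rule hermitian_spectral)
  note Vc = unitary_carrier[OF V]
  define P' Q' where "P' = adj V * P * V" and "Q' = adj V * Q * V"
  have P': "P' \<in> carrier_mat n n" "psd P'" "mtrace P' = mtrace P"
    and Q': "Q' \<in> carrier_mat n n" "psd Q'" "mtrace Q' = mtrace Q"
    using P Q Vc psd_conj[of _ n "adj V" n] mtrace_unitary_conj[OF unitary_adj[OF V]]
    by (auto simp: P'_def Q'_def)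
  have diff: "mat_diag n (\<lambda>i. of_real (l i)) = P' - Q'"
    using unitary_conj_spectral_mat[OF V, of "\<lambda>i. of_real (l i)"] P Q Vc
    by (simp add: P'_def Q'_def mat_mult_distribs D flip: Dl)
  have "\<bar>l i\<bar> \<le> Re (P' $$ (i, i)) + Re (Q' $$ (i, i))" if i: "i < n" for i
  proof -
    have "l i = Re (P' $$ (i, i)) - Re (Q' $$ (i, i))"
      using arg_cong[OF diff, of "\<lambda>A. Re (A $$ (i, i))"] i P' Q' by (simp add: mat_diag_def)
    then show ?thesis
      using psd_diag_nonneg[OF P'(2,1) i] psd_diag_nonneg[OF Q'(2,1) i]
      by (auto simp: less_eq_complex_def)
  qed
  then have "(\<Sum>i<n. \<bar>l i\<bar>) \<le> (\<Sum>i<n. Re (P' $$ (i, i)) + Re (Q' $$ (i, i)))"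
    by (intro sum_mono) simp
  also have "\<dots> = Re (mtrace P) + Re (mtrace Q)"
    using P' Q' by (simp add: mtrace_carrier sum.distrib flip: P'(3) Q'(3))
  finally show ?thesis
    using r by (simp add: Dl trace_norm_spectral_mat[OF V])
qed

lemma trace_bound_mono: "trace_bound n D r \<Longrightarrow> r \<le> s \<Longrightarrow> trace_bound n D s"
  by (force simp: trace_bound_def)

lemma trace_bound_carrier: "trace_bound n D r \<Longrightarrow> D \<in> carrier_mat n n"
  by (auto simp: trace_bound_def)

lemma trace_bound_psd:
  assumes "psd P" "P \<in> carrier_mat n n"
  shows "trace_bound n P (Re (mtrace P))"
  by (rule trace_boundI[of P n "0\<^sub>m n n"]) (use assms in auto)

lemma trace_bound_zero: "trace_bound n (0\<^sub>m n n) 0"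
  using trace_bound_psd[of "0\<^sub>m n n" n] by simp

lemma trace_bound_diff:
  assumes "trace_bound n D r" "trace_bound n E s"
  shows "trace_bound n (D - E) (r + s)"
proof -
  obtain P Q where PQ: "P \<in> carrier_mat n n" "Q \<in> carrier_mat n n" "psd P" "psd Q"
     "D = P - Q" "Re (mtrace P) + Re (mtrace Q) \<le> r" using assms(1) by (rule trace_boundE)
  obtain P' Q' where PQ': "P' \<in> carrier_mat n n" "Q' \<in> carrier_mat n n" "psd P'" "psd Q'"
     "E = P' - Q'" "Re (mtrace P') + Re (mtrace Q') \<le> s" using assms(2) by (rule trace_boundE)
  show ?thesis
    by (rule trace_boundI[of "P + Q'" n "Q + P'"])
      (use PQ PQ' in \<open>auto simp: mtrace_add intro: psd_add intro!: eq_matI\<close>)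
qed

lemma trace_bound_add:
  assumes "trace_bound n D r" "trace_bound n E s"
  shows "trace_bound n (D + E) (r + s)"
proof -
  have "D + E = D - (0\<^sub>m n n - E)"
    using assms[THEN trace_bound_carrier] by (intro eq_matI) auto
  then show ?thesis
    using trace_bound_diff[OF assms(1) trace_bound_diff[OF trace_bound_zero assms(2)]] by simp
qed

lemma trace_bound_smult:
  assumes "trace_bound n D r" "a \<ge> 0"
  shows "trace_bound n (of_real a \<cdot>\<^sub>m D) (a * r)"
proof -
  obtain P Q where PQ: "P \<in> carrier_mat n n" "Q \<in> carrier_mat n n" "psd P" "psd Q"
     "D = P - Q" "Re (mtrace P) + Re (mtrace Q) \<le> r" using assms(1) by (rule trace_boundE)
  have "psd (of_real a \<cdot>\<^sub>m P)" "psd (of_real a \<cdot>\<^sub>m Q)"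
    using PQ assms(2) by (auto intro!: psd_smult simp: less_eq_complex_def)
  moreover have "a * Re (mtrace P) + a * Re (mtrace Q) \<le> a * r"
    using PQ(6) assms(2) by (simp add: mult_left_mono flip: distrib_left)
  ultimately show ?thesis
    by (intro trace_boundI[of "of_real a \<cdot>\<^sub>m P" n "of_real a \<cdot>\<^sub>m Q"])
      (use PQ in \<open>auto simp: mtrace_smult right_diff_distrib intro!: eq_matI\<close>)
qed

lemma trace_bound_unitary_conj:
  assumes "trace_bound n D r" "unitary n U"
  shows "trace_bound n (U * D * adj U) r"
proof -
  obtain P Q where PQ: "P \<in> carrier_mat n n" "Q \<in> carrier_mat n n" "psd P" "psd Q"
     "D = P - Q" "Re (mtrace P) + Re (mtrace Q) \<le> r" using assms(1) by (rule trace_boundE)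
  note U = unitary_carrier[OF assms(2)]
  have "psd (U * P * adj U)" "psd (U * Q * adj U)"
    using PQ U by (auto intro: psd_conj)
  moreover have "U * D * adj U = U * P * adj U - U * Q * adj U"
    using PQ U by (simp add: mat_mult_distribs)
  ultimately show ?thesis
    using PQ U by (intro trace_boundI[of "U * P * adj U" n "U * Q * adj U"])
      (auto simp: mtrace_unitary_conj[OF assms(2)])
qed

text \<open>Polarization: \<open>2 r (X S Y\<^sup>* + Y S X\<^sup>*)\<close> is the difference of the positive matrices
  \<open>(r X \<plusminus> Y) S (r X \<plusminus> Y)\<^sup>*\<close>.\<close>

lemma trace_bound_cross:
  assumes S: "psd S" "S \<in> carrier_mat n n" and X: "X \<in> carrier_mat n n"
    and Y: "Y \<in> carrier_mat n n" and r: "r > 0"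
  shows "trace_bound n (X * S * adj Y + Y * S * adj X)
    (r * Re (mtrace (X * S * adj X)) + Re (mtrace (Y * S * adj Y)) / r)"
proof -
  define half :: complex where "half = of_real (1 / (2 * r))"
  define Z where "Z s = of_real r \<cdot>\<^sub>m X + of_real s \<cdot>\<^sub>m Y" for s
  define P where "P s = half \<cdot>\<^sub>m (Z s * S * adj (Z s))" for s
  have Z: "Z s \<in> carrier_mat n n" for s
    using Y by (auto simp: Z_def)
  have conj_Z: "Z s * S * adj (Z s) \<in> carrier_mat n n" for s
    using Z[of s] by auto
  then have P: "P s \<in> carrier_mat n n" for s
    by (simp add: P_def)
  have psd_P: "psd (P s)" for s
    unfolding P_def half_def using r
    by (intro psd_smult[OF psd_conj[OF S Z] conj_Z]) (simp add: less_eq_complex_def)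
  have expand: "Z s * S * adj (Z s) = of_real (r * r) \<cdot>\<^sub>m (X * S * adj X)
    + of_real (r * s) \<cdot>\<^sub>m (X * S * adj Y)
      + (of_real (r * s) \<cdot>\<^sub>m (Y * S * adj X) + of_real (s * s) \<cdot>\<^sub>m (Y * S * adj Y))" for s
    using X Y S
    by (simp add: Z_def adj_linear mat_mult_distribs)
      (auto simp: distrib_left mult.assoc intro!: eq_matI)
  have "X * S * adj Y + Y * S * adj X = P 1 - P (- 1)"
    unfolding P_def expand half_def using X Y S r by (intro eq_matI) (auto simp: field_simps)
  moreover have "Re (mtrace (P 1)) + Re (mtrace (P (- 1))) \<le>
    r * Re (mtrace (X * S * adj X)) + Re (mtrace (Y * S * adj Y)) / r"
  proof -
    have "P 1 + P (- 1) = of_real r \<cdot>\<^sub>m (X * S * adj X) + of_real (1 / r) \<cdot>\<^sub>m (Y * S * adj Y)"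
      unfolding P_def expand half_def using X Y S r by (intro eq_matI) (auto simp: field_simps)
    from arg_cong[OF this, of "\<lambda>A. Re (mtrace A)"] show ?thesis
      using P[of 1] P[of "- 1"] X Y S by (simp add: mtrace_add mtrace_smult)
  qed
  ultimately show ?thesis
    using P psd_P by (intro trace_boundI[of "P 1" n "P (- 1)"])
qed

section \<open>Kronecker products\<close>

lemma sum_div_mod: "(\<Sum>l<m * q. f (l div q) (l mod q)) = (\<Sum>a<m. \<Sum>b<q. f a b)"
  for f :: "nat \<Rightarrow> nat \<Rightarrow> 'a::comm_monoid_add"
proof -
  have "(\<Sum>l=a * q..<a * q + q. f (l div q) (l mod q)) = (\<Sum>b<q. f a b)" for a
    using sum.shift_bounds_nat_ivl[of "\<lambda>l. f (l div q) (l mod q)" 0 "a * q" q]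
    by (simp add: lessThan_atLeast0 add.commute)
  then show ?thesis
    by (simp flip: sum.nat_group)
qed

lemma div_mod_less: "i < n * p \<Longrightarrow> i div p < n" "i < n * p \<Longrightarrow> i mod p < p" for i n p :: nat
  by (auto simp: less_mult_imp_div_less intro!: mod_less_divisor gr0I)

lemma dim_kron [simp]:
  "dim_row (kron A B) = dim_row A * dim_row B" "dim_col (kron A B) = dim_col A * dim_col B"
  by (simp_all add: kron_def)

lemma kron_carrier [simp]:
  "A \<in> carrier_mat n m \<Longrightarrow> B \<in> carrier_mat p q \<Longrightarrow> kron A B \<in> carrier_mat (n * p) (m * q)"
  by auto

lemma kron_index:
  "i < dim_row A * dim_row B \<Longrightarrow> j < dim_col A * dim_col B \<Longrightarrow>
    kron A B $$ (i, j) =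
      A $$ (i div dim_row B, j div dim_col B) * B $$ (i mod dim_row B, j mod dim_col B)"
  by (simp add: kron_def)

lemma kron_mult:
  assumes "dim_col A = dim_row C" "dim_col B = dim_row D"
  shows "kron A B * kron C D = kron (A * C) (B * D)"
proof (rule eq_matI)
  fix i j assume "i < dim_row (kron (A * C) (B * D))" "j < dim_col (kron (A * C) (B * D))"
  then have ij: "i < dim_row A * dim_row B" "j < dim_col C * dim_col D" by auto
  let ?a = "\<lambda>k. A $$ (i div dim_row B, k) * C $$ (k, j div dim_col D)"
  let ?b = "\<lambda>k. B $$ (i mod dim_row B, k) * D $$ (k, j mod dim_col D)"
  have "(kron A B * kron C D) $$ (i, j) =
    (\<Sum>r<dim_row C * dim_row D. ?a (r div dim_row D) * ?b (r mod dim_row D))"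
    using assms ij by (simp add: index_mult_mat_sum kron_index mult_ac)
  also have "\<dots> = (\<Sum>k<dim_row C. ?a k) * (\<Sum>k<dim_row D. ?b k)"
    unfolding sum_product by (rule sum_div_mod)
  also have "\<dots> = kron (A * C) (B * D) $$ (i, j)"
    using assms ij by (simp add: index_mult_mat_sum kron_index div_mod_less)
  finally show "(kron A B * kron C D) $$ (i, j) = kron (A * C) (B * D) $$ (i, j)" .
qed auto

lemma adj_kron: "adj (kron A B) = kron (adj A) (adj B)"
  by (rule eq_matI) (simp_all add: kron_index div_mod_less)

lemma kron_mat_diag:
  "kron (mat_diag n f) (mat_diag m g) = mat_diag (n * m) (\<lambda>i. f (i div m) * g (i mod m))"
proof (rule eq_matI)
  fix i j assume "i < dim_row (mat_diag (n * m) (\<lambda>i. f (i div m) * g (i mod m)))"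
    "j < dim_col (mat_diag (n * m) (\<lambda>i. f (i div m) * g (i mod m)))"
  moreover have "i div m = j div m \<and> i mod m = j mod m \<longleftrightarrow> i = j"
    by (metis div_mult_mod_eq)
  ultimately show "kron (mat_diag n f) (mat_diag m g) $$ (i, j) =
    mat_diag (n * m) (\<lambda>i. f (i div m) * g (i mod m)) $$ (i, j)"
    by (auto simp: kron_index mat_diag_def div_mod_less)
qed auto

lemma kron_one: "kron (1\<^sub>m n) (1\<^sub>m m) = 1\<^sub>m (n * m)"
  using kron_mat_diag[of n "\<lambda>_. 1" m "\<lambda>_. 1"] by simp

lemma kron_one_right: "kron A (1\<^sub>m 1) = A"
  by (rule eq_matI) (auto simp: kron_def)

lemma kron_assoc: "kron (kron A B) C = kron A (kron B C)"
proof (rule eq_matI)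
  fix i j assume "i < dim_row (kron A (kron B C))" "j < dim_col (kron A (kron B C))"
  then have ij: "i < dim_row A * dim_row B * dim_row C" "j < dim_col A * dim_col B * dim_col C"
    by (simp_all add: mult.assoc)
  have div_mod: "k mod (p * q) div q = k div q mod p" "k mod (p * q) mod q = k mod q"
    "k div q div p = k div (p * q)"
    for k p q :: nat
    by (cases "q = 0"; simp add: mod_mult2_eq div_mult2_eq mult.commute[of p])+
  show "kron (kron A B) C $$ (i, j) = kron A (kron B C) $$ (i, j)"
    using ij by (simp add: kron_index div_mod_less mult.assoc[symmetric] div_mod)
qed (auto simp: mult.assoc)

lemma kron_add_left:
  "dim_row A = dim_row B \<Longrightarrow> dim_col A = dim_col B \<Longrightarrow> kron (A + B) C = kron A C + kron B C"
  by (rule eq_matI) (simp_all add: kron_index div_mod_less distrib_right)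

lemma kron_smult_left: "kron (a \<cdot>\<^sub>m A) B = a \<cdot>\<^sub>m kron A B"
  by (rule eq_matI) (simp_all add: kron_index div_mod_less)

lemma unitary_kron:
  assumes "unitary n V" "unitary m W"
  shows "unitary (n * m) (kron V W)"
  using assms[THEN unitary_carrier] assms[THEN unitary_inverse(1)]
  by (intro unitaryI) (simp_all add: adj_kron kron_mult kron_one)

lemma kron_spectral_mat_one:
  "kron (spectral_mat V f) (1\<^sub>m m) = spectral_mat (kron V (1\<^sub>m m)) (\<lambda>i. f (i div m))"
proof -
  have "mat_diag (dim_col V * m) (\<lambda>i. f (i div m)) = kron (mat_diag (dim_col V) f) (1\<^sub>m m)"
    using kron_mat_diag[of "dim_col V" f m "\<lambda>_. 1"] by simp
  then show ?thesis
    by (simp add: spectral_mat_def adj_kron kron_mult)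
qed

lemma psd_kron:
  assumes "psd A" "A \<in> carrier_mat n n" "psd B" "B \<in> carrier_mat m m"
  shows "psd (kron A B)"
proof -
  obtain C where C: "C \<in> carrier_mat n n" "A = C * adj C"
    using psd_factor[OF assms(1,2)] .
  obtain D where D: "D \<in> carrier_mat m m" "B = D * adj D"
    using psd_factor[OF assms(3,4)] .
  have "kron A B = kron C D * adj (kron C D)"
    using C D by (simp add: adj_kron kron_mult)
  then show ?thesis
    using psd_gram[OF kron_carrier[OF C(1) D(1)]] by simp
qed

lemma mtrace_kron:
  assumes "A \<in> carrier_mat n n" "B \<in> carrier_mat m m"
  shows "mtrace (kron A B) = mtrace A * mtrace B"
proof -
  have "mtrace (kron A B) = (\<Sum>i<n * m. A $$ (i div m, i div m) * B $$ (i mod m, i mod m))"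
    using assms by (simp add: mtrace_def kron_index)
  also have "\<dots> = (\<Sum>a<n. \<Sum>b<m. A $$ (a, a) * B $$ (b, b))"
    by (rule sum_div_mod)
  finally show ?thesis
    using assms by (simp add: mtrace_def sum_product)
qed

section \<open>Sums of matrices and quantum channels\<close>

definition msum :: "nat \<Rightarrow> nat \<Rightarrow> ('a \<Rightarrow> complex mat) \<Rightarrow> 'a list \<Rightarrow> complex mat" where
  "msum n m f xs = mat n m (\<lambda>ij. \<Sum>x\<leftarrow>xs. f x $$ ij)"

lemma dim_msum [simp]: "dim_row (msum n m f xs) = n" "dim_col (msum n m f xs) = m"
  by (simp_all add: msum_def)

lemma msum_index: "i < n \<Longrightarrow> j < m \<Longrightarrow> msum n m f xs $$ (i, j) = (\<Sum>x\<leftarrow>xs. f x $$ (i, j))"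
  by (simp add: msum_def)

lemma msum_upt_index: "i < n \<Longrightarrow> j < m \<Longrightarrow> msum n m f [0..<K] $$ (i, j) = (\<Sum>k<K. f k $$ (i, j))"
  by (simp add: msum_index interv_sum_list_conv_sum_set_nat lessThan_atLeast0)

lemma msum_Nil [simp]: "msum n m f [] = 0\<^sub>m n m"
  by (rule eq_matI) (simp_all add: msum_index)

lemma msum_Cons [simp]: "msum n m f (x # xs) = f x + msum n m f xs"
  by (rule eq_matI) (simp_all add: msum_index)

lemma foldr_plus_eq_msum: "foldr (\<lambda>x M. f x + M) xs (0\<^sub>m n m) = msum n m f xs"
  by (induction xs) simp_all

lemma msum_cong: "(\<And>x. x \<in> set xs \<Longrightarrow> f x = g x) \<Longrightarrow> msum n m f xs = msum n m g xs"
  by (induction xs) simp_all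

lemma msum_map: "msum n m f (map g xs) = msum n m (\<lambda>x. f (g x)) xs"
  by (induction xs) simp_all

lemma msum_append: "msum n m f (xs @ ys) = msum n m f xs + msum n m f ys"
  by (rule eq_matI) (simp_all add: msum_index)

lemma msum_concat_map: "msum n m f (concat (map g xs)) = msum n m (\<lambda>x. msum n m f (g x)) xs"
  by (induction xs) (simp_all add: msum_append)

lemma msum_add:
  assumes "\<And>x. x \<in> set xs \<Longrightarrow> dim_row (f x) = n" "\<And>x. x \<in> set xs \<Longrightarrow> dim_col (f x) = m"
    and "\<And>x. x \<in> set xs \<Longrightarrow> dim_row (g x) = n" "\<And>x. x \<in> set xs \<Longrightarrow> dim_col (g x) = m"
  shows "msum n m (\<lambda>x. f x + g x) xs = msum n m f xs + msum n m g xs"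
  using assms by (induction xs) (auto intro!: eq_matI)

lemma msum_swap:
  assumes "\<And>x y. x \<in> set xs \<Longrightarrow> y \<in> set ys \<Longrightarrow> dim_row (f x y) = n"
    and "\<And>x y. x \<in> set xs \<Longrightarrow> y \<in> set ys \<Longrightarrow> dim_col (f x y) = m"
  shows "msum n m (\<lambda>x. msum n m (f x) ys) xs = msum n m (\<lambda>y. msum n m (\<lambda>x. f x y) xs) ys"
  using assms
proof (induction xs)
  case Nil
  show ?case
    by (rule eq_matI) (simp_all add: msum_index)
qed (simp add: msum_add)

lemma mult_msum:
  assumes "dim_col A = n" "\<And>x. x \<in> set xs \<Longrightarrow> dim_row (f x) = n" "\<And>x. x \<in> set xs \<Longrightarrow> dim_col (f x) = m"
  shows "A * msum n m f xs = msum (dim_row A) m (\<lambda>x. A * f x) xs"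
  using assms by (induction xs) (simp_all add: mult_add_mat)

lemma msum_mult:
  assumes "dim_row A = m" "\<And>x. x \<in> set xs \<Longrightarrow> dim_row (f x) = n" "\<And>x. x \<in> set xs \<Longrightarrow> dim_col (f x) = m"
  shows "msum n m f xs * A = msum n (dim_col A) (\<lambda>x. f x * A) xs"
  using assms by (induction xs) (simp_all add: add_mult_mat)

lemma smult_msum:
  assumes "\<And>x. x \<in> set xs \<Longrightarrow> dim_row (f x) = n" "\<And>x. x \<in> set xs \<Longrightarrow> dim_col (f x) = m"
  shows "a \<cdot>\<^sub>m msum n m f xs = msum n m (\<lambda>x. a \<cdot>\<^sub>m f x) xs"
  using assms by (induction xs) (simp_all add: smult_add_mat)

lemma kron_msum_left:
  assumes "\<And>x. x \<in> set xs \<Longrightarrow> dim_row (f x) = n" "\<And>x. x \<in> set xs \<Longrightarrow> dim_col (f x) = m"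
  shows "kron (msum n m f xs) C = msum (n * dim_row C) (m * dim_col C) (\<lambda>x. kron (f x) C) xs"
  using assms
proof (induction xs)
  case Nil
  show ?case
    by (rule eq_matI) (simp_all add: kron_index div_mod_less)
qed (simp add: kron_add_left)

lemma adj_msum:
  assumes "\<And>x. x \<in> set xs \<Longrightarrow> dim_row (f x) = n" "\<And>x. x \<in> set xs \<Longrightarrow> dim_col (f x) = m"
  shows "adj (msum n m f xs) = msum m n (\<lambda>x. adj (f x)) xs"
  using assms
proof (induction xs)
  case Nil
  show ?case
    by (rule eq_matI) simp_all
qed (simp add: adj_linear)

lemma psd_msum:
  "(\<And>x. x \<in> set xs \<Longrightarrow> f x \<in> carrier_mat n n) \<Longrightarrow> (\<And>x. x \<in> set xs \<Longrightarrow> psd (f x)) \<Longrightarrow> psd (msum n n f xs)"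
  by (induction xs) (auto intro!: psd_add[of _ _ n])

lemma mtrace_msum:
  assumes "\<And>x. x \<in> set xs \<Longrightarrow> dim_row (f x) = n" "\<And>x. x \<in> set xs \<Longrightarrow> dim_col (f x) = n"
  shows "mtrace (msum n n f xs) = (\<Sum>x\<leftarrow>xs. mtrace (f x))"
  using assms by (induction xs) (simp_all add: mtrace_add)

lemma is_channel_iff_msum:
  "is_channel n m Ks \<longleftrightarrow> (\<forall>K \<in> set Ks. K \<in> carrier_mat m n) \<and> msum n n (\<lambda>K. adj K * K) Ks = 1\<^sub>m n"
  by (simp add: is_channel_def foldr_plus_eq_msum)

lemma is_channelD:
  assumes "is_channel n m Ks"
  shows "K \<in> set Ks \<Longrightarrow> dim_row K = m" "K \<in> set Ks \<Longrightarrow> dim_col K = n"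
    and "msum n n (\<lambda>K. adj K * K) Ks = 1\<^sub>m n"
  using assms by (auto simp: is_channel_iff_msum)

lemma apply_channel_eq_msum: "apply_channel m Ks X = msum m m (\<lambda>K. K * X * adj K) Ks"
  by (simp add: apply_channel_def foldr_plus_eq_msum)

lemma dim_apply_channel [simp]:
  "dim_row (apply_channel m Ks X) = m" "dim_col (apply_channel m Ks X) = m"
  by (simp_all add: apply_channel_eq_msum)

lemma psd_apply_channel:
  assumes "is_channel n m Ks" "psd X" "X \<in> carrier_mat n n"
  shows "psd (apply_channel m Ks X)"
  unfolding apply_channel_eq_msum using assms(1)
  by (intro psd_msum psd_conj[OF assms(2,3)] carrier_matI) (auto simp: is_channel_def)

lemma mtrace_apply_channel:
  assumes ch: "is_channel n m Ks" and X: "X \<in> carrier_mat n n"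
  shows "mtrace (apply_channel m Ks X) = mtrace X"
proof -
  note dims = is_channelD(1,2)[OF ch]
  have "mtrace (apply_channel m Ks X) = (\<Sum>K\<leftarrow>Ks. mtrace (K * X * adj K))"
    unfolding apply_channel_eq_msum by (rule mtrace_msum) (simp_all add: dims)
  also have "\<dots> = (\<Sum>K\<leftarrow>Ks. mtrace (adj K * K * X))"
  proof (intro arg_cong[of _ _ sum_list] map_cong refl)
    fix K assume "K \<in> set Ks"
    then have K: "K \<in> carrier_mat m n"
      using dims by auto
    then show "mtrace (K * X * adj K) = mtrace (adj K * K * X)"
      using X mtrace_mult_comm[of "K * X" m n "adj K"] by (simp add: mult_mat_assoc)
  qed
  also have "\<dots> = mtrace (msum n n (\<lambda>K. adj K * K) Ks * X)"
    using X dims by (simp add: msum_mult mtrace_msum)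
  finally show ?thesis
    using X by (simp add: is_channelD(3)[OF ch])
qed

lemma apply_channel_msum:
  assumes ch: "is_channel n m Ks"
    and dims: "\<And>x. x \<in> set xs \<Longrightarrow> dim_row (f x) = n" "\<And>x. x \<in> set xs \<Longrightarrow> dim_col (f x) = n"
  shows "apply_channel m Ks (msum n n f xs) = msum m m (\<lambda>x. apply_channel m Ks (f x)) xs"
proof -
  have "apply_channel m Ks (msum n n f xs) = msum m m (\<lambda>K. msum m m (\<lambda>x. K * f x * adj K) xs) Ks"
    unfolding apply_channel_eq_msum
    by (rule msum_cong) (simp add: is_channelD(1,2)[OF ch] dims mult_msum msum_mult)
  also have "\<dots> = msum m m (\<lambda>x. apply_channel m Ks (f x)) xs"
    unfolding apply_channel_eq_msum by (rule msum_swap) (simp_all add: is_channelD(1)[OF ch])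
  finally show ?thesis .
qed

lemma apply_channel_smult:
  assumes "is_channel n m Ks" "dim_row X = n" "dim_col X = n"
  shows "apply_channel m Ks (a \<cdot>\<^sub>m X) = a \<cdot>\<^sub>m apply_channel m Ks X"
proof -
  note dims = is_channelD(1,2)[OF assms(1)]
  have "apply_channel m Ks (a \<cdot>\<^sub>m X) = msum m m (\<lambda>K. a \<cdot>\<^sub>m (K * X * adj K)) Ks"
    unfolding apply_channel_eq_msum using assms(2,3)
    by (intro msum_cong) (simp add: dims mat_mult_distribs)
  then show ?thesis
    unfolding apply_channel_eq_msum by (simp add: smult_msum dims)
qed

lemma apply_channel_add:
  assumes "is_channel n m Ks" "dim_row X = n" "dim_col X = n" "dim_row Y = n" "dim_col Y = n"
  shows "apply_channel m Ks (X + Y) = apply_channel m Ks X + apply_channel m Ks Y"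
proof -
  note dims = is_channelD(1,2)[OF assms(1)]
  have "apply_channel m Ks (X + Y) = msum m m (\<lambda>K. K * X * adj K + K * Y * adj K) Ks"
    unfolding apply_channel_eq_msum using assms(2-5)
    by (intro msum_cong) (simp add: dims mat_mult_distribs)
  then show ?thesis
    unfolding apply_channel_eq_msum by (simp add: msum_add dims)
qed

lemma adj_apply_channel:
  assumes "is_channel n m Ks" "dim_row X = n" "dim_col X = n"
  shows "adj (apply_channel m Ks X) = apply_channel m Ks (adj X)"
proof -
  note dims = is_channelD(1,2)[OF assms(1)]
  have "adj (apply_channel m Ks X) = msum m m (\<lambda>K. adj (K * X * adj K)) Ks"
    unfolding apply_channel_eq_msum by (rule adj_msum) (simp_all add: dims)
  also have "\<dots> = apply_channel m Ks (adj X)"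
    unfolding apply_channel_eq_msum using assms(2,3)
    by (intro msum_cong) (simp add: dims adj_mult mult_mat_assoc)
  finally show ?thesis .
qed

lemma is_channel_unitary: "unitary n U \<Longrightarrow> is_channel n n [U]"
  by (simp add: is_channel_def unitary_def)

lemma apply_channel_unitary: "unitary n U \<Longrightarrow> apply_channel n [U] X = U * X * adj U"
  using unitary_carrier by (fastforce simp: apply_channel_def)

definition channel_comp :: "complex mat list \<Rightarrow> complex mat list \<Rightarrow> complex mat list" where
  "channel_comp Ms Ls = concat (map (\<lambda>M. map (\<lambda>L. M * L) Ls) Ms)"

lemma is_channel_comp:
  assumes L: "is_channel n m Ls" and M: "is_channel m k Ms"
  shows "is_channel n k (channel_comp Ms Ls)"
  unfolding is_channel_iff_msum
proof
  note dims = is_channelD(1,2)[OF L] is_channelD(1,2)[OF M]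
  show "\<forall>K \<in> set (channel_comp Ms Ls). K \<in> carrier_mat k n"
    by (auto simp: channel_comp_def dims)
  have "msum n n (\<lambda>K. adj K * K) (channel_comp Ms Ls) =
      msum n n (\<lambda>M. msum n n (\<lambda>L. adj L * (adj M * M) * L) Ls) Ms"
    unfolding channel_comp_def msum_concat_map msum_map
    by (intro msum_cong) (simp add: dims adj_mult mult_mat_assoc)
  also have "\<dots> = msum n n (\<lambda>L. msum n n (\<lambda>M. adj L * (adj M * M) * L) Ms) Ls"
    by (rule msum_swap) (simp_all add: dims)
  also have "\<dots> = msum n n (\<lambda>L. adj L * msum m m (\<lambda>M. adj M * M) Ms * L) Ls"
    by (intro msum_cong) (simp add: dims mult_msum msum_mult)
  also have "\<dots> = msum n n (\<lambda>L. adj L * L) Ls"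
    by (intro msum_cong) (simp add: dims is_channelD(3)[OF M])
  finally show "msum n n (\<lambda>K. adj K * K) (channel_comp Ms Ls) = 1\<^sub>m n"
    by (simp add: is_channelD(3)[OF L])
qed

lemma apply_channel_comp:
  assumes L: "is_channel n m Ls" and M: "is_channel m k Ms" and X: "X \<in> carrier_mat n n"
  shows "apply_channel k (channel_comp Ms Ls) X = apply_channel k Ms (apply_channel m Ls X)"
proof -
  note dims = is_channelD(1,2)[OF L] is_channelD(1,2)[OF M]
  have "apply_channel k (channel_comp Ms Ls) X =
    msum k k (\<lambda>M. msum k k (\<lambda>L. M * (L * X * adj L) * adj M) Ls) Ms"
    unfolding apply_channel_eq_msum channel_comp_def msum_concat_map msum_map using X
    by (intro msum_cong) (simp add: dims adj_mult mult_mat_assoc)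
  also have "\<dots> = apply_channel k Ms (apply_channel m Ls X)"
    unfolding apply_channel_eq_msum by (intro msum_cong) (simp add: dims mult_msum msum_mult)
  finally show ?thesis .
qed

definition channel_tensor_id :: "nat \<Rightarrow> complex mat list \<Rightarrow> complex mat list" where
  "channel_tensor_id e Ls = map (\<lambda>L. kron L (1\<^sub>m e)) Ls"

lemma is_channel_tensor_id:
  assumes "is_channel n m Ls"
  shows "is_channel (n * e) (m * e) (channel_tensor_id e Ls)"
  unfolding is_channel_iff_msum
proof
  note dims = is_channelD(1,2)[OF assms]
  show "\<forall>K \<in> set (channel_tensor_id e Ls). K \<in> carrier_mat (m * e) (n * e)"
    by (auto simp: channel_tensor_id_def dims)
  have "msum (n * e) (n * e) (\<lambda>K. adj K * K) (channel_tensor_id e Ls) =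
      msum (n * e) (n * e) (\<lambda>L. kron (adj L * L) (1\<^sub>m e)) Ls"
    unfolding channel_tensor_id_def msum_map by (intro msum_cong) (simp add: adj_kron kron_mult)
  also have "\<dots> = kron (msum n n (\<lambda>L. adj L * L) Ls) (1\<^sub>m e)"
    by (simp add: kron_msum_left dims)
  finally show "msum (n * e) (n * e) (\<lambda>K. adj K * K) (channel_tensor_id e Ls) = 1\<^sub>m (n * e)"
    by (simp add: is_channelD(3)[OF assms] kron_one)
qed

lemma apply_channel_tensor_id:
  assumes "is_channel n m Ls" "X \<in> carrier_mat n n" "Y \<in> carrier_mat e e"
  shows "apply_channel (m * e) (channel_tensor_id e Ls) (kron X Y) = kron (apply_channel m Ls X) Y"
proof -
  note dims = is_channelD(1,2)[OF assms(1)]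
  have "apply_channel (m * e) (channel_tensor_id e Ls) (kron X Y) =
      msum (m * e) (m * e) (\<lambda>L. kron (L * X * adj L) Y) Ls"
    unfolding apply_channel_eq_msum channel_tensor_id_def msum_map using assms(2,3)
    by (intro msum_cong) (simp add: dims adj_kron kron_mult)
  then show ?thesis
    unfolding apply_channel_eq_msum using assms(3) by (simp add: kron_msum_left dims)
qed

section \<open>Density operators\<close>

lemma densityD:
  assumes "density n X"
  shows "X \<in> carrier_mat n n" "psd X" "mtrace X = 1"
  using assms by (simp_all add: density_def)

lemma density_apply_channel:
  assumes "is_channel n m Ks" "density n X"
  shows "density m (apply_channel m Ks X)"
  using psd_apply_channel[OF assms(1)] mtrace_apply_channel[OF assms(1)] densityD[OF assms(2)]
  by (auto simp: density_def)

lemma density_kron: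
  assumes "density n X" "density m Y"
  shows "density (n * m) (kron X Y)"
  using assms by (auto simp: density_def mtrace_kron[of _ n _ m] intro: psd_kron)

lemma density_unitary_conj:
  assumes "unitary n U" "density n X"
  shows "density n (U * X * adj U)"
  using density_apply_channel[OF is_channel_unitary[OF assms(1)] assms(2)]
    apply_channel_unitary[OF assms(1)]
  by simp

lemma density_diag_le_1:
  assumes "density n X" "i < n"
  shows "0 \<le> X $$ (i, i)" "X $$ (i, i) \<le> 1"
proof -
  note X = densityD[OF assms(1)]
  show "0 \<le> X $$ (i, i)"
    using X assms(2) by (intro psd_diag_nonneg)
  have "X $$ (i, i) \<le> (\<Sum>k<n. X $$ (k, k))"
    using X assms(2) by (intro member_le_sum psd_diag_nonneg[OF X(2,1)]) auto
  then show "X $$ (i, i) \<le> 1"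
    using X by (simp add: mtrace_carrier)
qed

lemma density_convex_combination:
  assumes "\<And>j. j < K \<Longrightarrow> density n (Y j)" "\<And>j. j < K \<Longrightarrow> w j \<ge> (0::real)" "(\<Sum>j<K. w j) = 1"
  shows "density n (msum n n (\<lambda>j. of_real (w j) \<cdot>\<^sub>m Y j) [0..<K])"
proof -
  note Y = densityD[OF assms(1)]
  have dims: "\<And>j. j < K \<Longrightarrow> dim_row (Y j) = n" "\<And>j. j < K \<Longrightarrow> dim_col (Y j) = n"
    using Y(1) by auto
  have "psd (msum n n (\<lambda>j. of_real (w j) \<cdot>\<^sub>m Y j) [0..<K])"
    using assms(2) Y by (intro psd_msum psd_smult[of _ n]) (auto simp: less_eq_complex_def)
  moreover have "mtrace (msum n n (\<lambda>j. of_real (w j) \<cdot>\<^sub>m Y j) [0..<K]) =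
    (\<Sum>j\<leftarrow>[0..<K]. mtrace (of_real (w j) \<cdot>\<^sub>m Y j))"
    by (rule mtrace_msum) (simp_all add: dims)
  moreover have "\<dots> = (\<Sum>j<K. of_real (w j))"
    using Y(3) by (simp add: interv_sum_list_conv_sum_set_nat lessThan_atLeast0 mtrace_smult dims)
  ultimately show ?thesis
    using assms(3) by (simp add: density_def carrier_matI flip: of_real_sum)
qed

section \<open>Repeated interactions with sampled states\<close>

text \<open>\<open>\<Psi> j\<close> is an interaction of the system with one sample. The sample register is consumed from
  the left: the first interaction absorbs the first sample and leaves the remaining ones untouched.\<close>

fun seq_channel :: "nat \<Rightarrow> nat \<Rightarrow> ('a \<Rightarrow> complex mat list) \<Rightarrow> 'a list \<Rightarrow> complex mat list" where
  "seq_channel N d \<Psi> [] = [1\<^sub>m N]"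
| "seq_channel N d \<Psi> (j # js) =
    channel_comp (seq_channel N d \<Psi> js) (channel_tensor_id (d ^ length js) (\<Psi> j))"

lemma is_channel_tensor_sample:
  "is_channel (N * d) N Ls \<Longrightarrow> is_channel (N * d ^ Suc k) (N * d ^ k) (channel_tensor_id (d ^ k) Ls)"
  using is_channel_tensor_id[of "N * d" N Ls "d ^ k"] by (simp add: mult.assoc)

lemma is_channel_seq_channel:
  "(\<And>j. j \<in> set js \<Longrightarrow> is_channel (N * d) N (\<Psi> j)) \<Longrightarrow>
    is_channel (N * d ^ length js) N (seq_channel N d \<Psi> js)"
proof (induction js)
  case (Cons j js)
  then show ?case
    using is_channel_comp[OF is_channel_tensor_sample[of N d "\<Psi> j" "length js"]]
    by (simp del: power_Suc)
qed (simp add: is_channel_unitary unitary_one)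

lemma kron_list_carrier:
  "(\<And>j. j \<in> set js \<Longrightarrow> \<rho> j \<in> carrier_mat d d) \<Longrightarrow>
    kron_list (map \<rho> js) \<in> carrier_mat (d ^ length js) (d ^ length js)"
  by (induction js) auto

lemma apply_seq_channel_Cons:
  assumes \<Psi>: "\<And>i. i \<in> set (j # js) \<Longrightarrow> is_channel (N * d) N (\<Psi> i)"
    and \<rho>: "\<And>i. i \<in> set (j # js) \<Longrightarrow> \<rho> i \<in> carrier_mat d d" and X: "X \<in> carrier_mat N N"
  shows "apply_channel N (seq_channel N d \<Psi> (j # js)) (kron X (kron_list (map \<rho> (j # js)))) =
    apply_channel N (seq_channel N d \<Psi> js)
      (kron (apply_channel N (\<Psi> j) (kron X (\<rho> j))) (kron_list (map \<rho> js)))"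
proof -
  let ?R = "kron_list (map \<rho> js)" and ?k = "length js"
  have R: "?R \<in> carrier_mat (d ^ ?k) (d ^ ?k)" and X\<rho>: "kron X (\<rho> j) \<in> carrier_mat (N * d) (N * d)"
    using \<rho> X by (auto intro: kron_list_carrier)
  have "kron (kron X (\<rho> j)) ?R \<in> carrier_mat (N * d ^ Suc ?k) (N * d ^ Suc ?k)"
    using kron_carrier[OF X\<rho> R] by (simp add: mult.assoc)
  then show ?thesis
    using apply_channel_comp[OF is_channel_tensor_sample is_channel_seq_channel,
        of N d "\<Psi> j" js \<Psi> "kron (kron X (\<rho> j)) ?R"]
      apply_channel_tensor_id[OF _ X\<rho> R, of N "\<Psi> j"] \<Psi>
    by (simp add: kron_assoc)
qed

definition mean_step ::
  "nat \<Rightarrow> nat \<Rightarrow> (nat \<Rightarrow> real) \<Rightarrow> (nat \<Rightarrow> complex mat list) \<Rightarrow> (nat \<Rightarrow> complex mat) \<Rightarrow>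
    complex mat \<Rightarrow> complex mat" where
  "mean_step N K w \<Psi> \<rho> X = msum N N (\<lambda>j. of_real (w j) \<cdot>\<^sub>m apply_channel N (\<Psi> j) (kron X (\<rho> j))) [0..<K]"

lemma dim_mean_step [simp]: "dim_row (mean_step N K w \<Psi> \<rho> X) = N" "dim_col (mean_step N K w \<Psi> \<rho> X) = N"
  by (simp_all add: mean_step_def)

lemma density_mean_step:
  assumes "\<And>j. j < K \<Longrightarrow> is_channel (N * d) N (\<Psi> j)" "\<And>j. j < K \<Longrightarrow> density d (\<rho> j)" "density N X"
    and "\<And>j. j < K \<Longrightarrow> w j \<ge> 0" "(\<Sum>j<K. w j) = 1"
  shows "density N (mean_step N K w \<Psi> \<rho> X)"
  unfolding mean_step_def using assms
  by (intro density_convex_combination density_apply_channel) (auto intro: density_kron)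

lemma apply_seq_channel_mean_step:
  assumes \<Psi>: "\<And>j. j < K \<Longrightarrow> is_channel (N * d) N (\<Psi> j)" and \<rho>: "\<And>j. j < K \<Longrightarrow> \<rho> j \<in> carrier_mat d d"
    and js: "set js \<subseteq> {..<K}" and X: "X \<in> carrier_mat N N"
  shows "apply_channel N (seq_channel N d \<Psi> js) (kron (mean_step N K w \<Psi> \<rho> X) (kron_list (map \<rho> js))) =
    msum N N (\<lambda>j. of_real (w j) \<cdot>\<^sub>m
      apply_channel N (seq_channel N d \<Psi> (j # js)) (kron X (kron_list (map \<rho> (j # js))))) [0..<K]"
proof -
  let ?R = "kron_list (map \<rho> js)" and ?step = "\<lambda>j. apply_channel N (\<Psi> j) (kron X (\<rho> j))"
  have seq: "is_channel (N * d ^ length js) N (seq_channel N d \<Psi> js)"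
    using js \<Psi> by (intro is_channel_seq_channel) auto
  have R: "?R \<in> carrier_mat (d ^ length js) (d ^ length js)"
    using js \<rho> by (intro kron_list_carrier) auto
  have "apply_channel N (seq_channel N d \<Psi> js) (kron (mean_step N K w \<Psi> \<rho> X) ?R) =
      msum N N (\<lambda>j. of_real (w j) \<cdot>\<^sub>m apply_channel N (seq_channel N d \<Psi> js) (kron (?step j) ?R))
        [0..<K]"
    unfolding mean_step_def using R
    by (simp add: kron_msum_left kron_smult_left apply_channel_msum[OF seq] apply_channel_smult[OF seq])
  also have "\<dots> = msum N N (\<lambda>j. of_real (w j) \<cdot>\<^sub>m
      apply_channel N (seq_channel N d \<Psi> (j # js)) (kron X (kron_list (map \<rho> (j # js))))) [0..<K]"
    using js \<Psi> \<rho> X by (intro msum_cong arg_cong[of _ _ "(\<cdot>\<^sub>m) _"] apply_seq_channel_Cons[symmetric]) auto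
  finally show ?thesis .
qed

abbreviation sample_seqs :: "nat \<Rightarrow> nat \<Rightarrow> nat list set" where
  "sample_seqs K n \<equiv> set (List.n_lists n [0..<K])"

lemma protocol_output_eq_msum:
  assumes "distinct xs"
  shows "protocol_output dA dB (set xs) p \<Phi> \<rho> \<sigma> =
    msum (dA * dB) (dA * dB)
      (\<lambda>js. of_real (p js) \<cdot>\<^sub>m apply_channel (dA * dB) (\<Phi> js) (kron \<sigma> (kron_list (map \<rho> js)))) xs"
  using assms
  by (intro eq_matI) (simp_all add: protocol_output_def msum_index sum_list_distinct_conv_sum_set)

lemma protocol_output_sampling:
  assumes \<Psi>: "\<And>j. j < K \<Longrightarrow> is_channel (dA * dB * dA) (dA * dB) (\<Psi> j)"
    and \<rho>: "\<And>j. j < K \<Longrightarrow> \<rho> j \<in> carrier_mat dA dA" and X: "X \<in> carrier_mat (dA * dB) (dA * dB)"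
  shows "protocol_output dA dB (sample_seqs K n) (\<lambda>js. prod_list (map w js))
    (seq_channel (dA * dB) dA \<Psi>) \<rho> X =
    (mean_step (dA * dB) K w \<Psi> \<rho> ^^ n) X"
  unfolding protocol_output_eq_msum[OF distinct_n_lists[OF distinct_upt]] using X
proof (induction n arbitrary: X)
  case 0
  then show ?case
    by (auto simp: apply_channel_unitary[OF unitary_one] kron_one_right[unfolded One_nat_def])
next
  case (Suc n)
  let ?N = "dA * dB" and ?p = "\<lambda>js. prod_list (map w js)" and ?L = "List.n_lists n [0..<K]"
  let ?run = "\<lambda>X js. apply_channel ?N (seq_channel ?N dA \<Psi> js) (kron X (kron_list (map \<rho> js)))"
  let ?Y = "mean_step ?N K w \<Psi> \<rho> X"
  have "msum ?N ?N (\<lambda>j. of_real (?p (j # js)) \<cdot>\<^sub>m ?run X (j # js)) [0..<K] =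
    of_real (?p js) \<cdot>\<^sub>m ?run ?Y js"
    if "js \<in> set ?L" for js
  proof -
    have "?run ?Y js = msum ?N ?N (\<lambda>j. of_real (w j) \<cdot>\<^sub>m ?run X (j # js)) [0..<K]"
      using that by (intro apply_seq_channel_mean_step[OF \<Psi> \<rho> _ Suc.prems]) (auto simp: set_n_lists)
    then show ?thesis
      by (simp only: smult_msum dim_apply_channel index_smult_mat smult_smult_mat)
        (simp add: mult.commute)
  qed
  then have "msum ?N ?N (\<lambda>js. of_real (?p js) \<cdot>\<^sub>m ?run X js) (List.n_lists (Suc n) [0..<K]) =
      msum ?N ?N (\<lambda>js. of_real (?p js) \<cdot>\<^sub>m ?run ?Y js) ?L"
    unfolding List.n_lists.simps msum_concat_map msum_map by (intro msum_cong)
  also have "\<dots> = (mean_step ?N K w \<Psi> \<rho> ^^ n) ?Y"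
    by (rule Suc.IH) auto
  finally show ?case
    by (simp only: funpow_Suc_right comp_apply)
qed

lemma sum_n_lists_Suc:
  fixes f :: "nat list \<Rightarrow> 'a::comm_monoid_add"
  shows "(\<Sum>js\<in>sample_seqs K (Suc n). f js) = (\<Sum>js\<in>sample_seqs K n. \<Sum>j<K. f (j # js))"
proof -
  have "sample_seqs K (Suc n) = (\<lambda>(js, j). j # js) ` (sample_seqs K n \<times> {..<K})"
    by (auto simp: atLeast0LessThan)
  moreover have "inj_on (\<lambda>(js, j). j # js) (sample_seqs K n \<times> {..<K})"
    by (auto intro: inj_onI)
  ultimately show ?thesis
    by (simp only: sum.reindex sum.cartesian_product comp_def) (simp add: split_beta)
qed

lemma sum_prod_list_n_lists:
  fixes w :: "nat \<Rightarrow> real"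
  assumes "(\<Sum>j<K. w j) = 1"
  shows "(\<Sum>js\<in>sample_seqs K n. prod_list (map w js)) = 1"
proof (induction n)
  case (Suc n)
  then show ?case
    unfolding sum_n_lists_Suc by (simp add: assms flip: sum_distrib_right)
qed simp

lemma expected_count_list:
  fixes w :: "nat \<Rightarrow> real"
  assumes w: "(\<Sum>j<K. w j) = 1" and j: "j < K"
  shows "(\<Sum>js\<in>sample_seqs K n. prod_list (map w js) * real (count_list js j)) = real n * w j"
proof (induction n)
  case (Suc n)
  let ?L = "sample_seqs K n" and ?p = "\<lambda>js. prod_list (map w js)"
  have "(\<Sum>i<K. ?p (i # js) * real (count_list (i # js) j)) =
    ?p js * real (count_list js j) + ?p js * w j" for js
  proof -
    have "(\<Sum>i<K. ?p (i # js) * real (count_list (i # js) j)) =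
        (\<Sum>i<K. w i * (?p js * real (count_list js j)) + (if i = j then ?p js * w i else 0))"
      by (intro sum.cong refl) (simp add: algebra_simps)
    then show ?thesis
      using j by (simp add: sum.distrib w flip: sum_distrib_right)
  qed
  then show ?case
    unfolding sum_n_lists_Suc
    by (simp add: sum.distrib Suc sum_prod_list_n_lists[OF w] distrib_right flip: sum_distrib_right)
qed simp

lemma valid_protocol_sampling:
  assumes "\<And>j. j < K \<Longrightarrow> w j \<ge> 0" "n = 0 \<or> (\<Sum>j<K. w j) = 1"
    and "\<And>j. j < K \<Longrightarrow> is_channel (dA * dB * dA) (dA * dB) (\<Psi> j)"
  shows "valid_protocol dA dB K (sample_seqs K n) (\<lambda>js. prod_list (map w js))
    (seq_channel (dA * dB) dA \<Psi>)"
  unfolding valid_protocol_def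
proof (intro conjI ballI)
  show "(\<Sum>js\<in>sample_seqs K n. prod_list (map w js)) = 1"
    using assms(2) sum_prod_list_n_lists[of w K n] by auto
  fix js assume "js \<in> sample_seqs K n"
  then show js: "set js \<subseteq> {..<K}"
    by (auto simp: set_n_lists)
  then show "is_channel (dA * dB * dA ^ length js) (dA * dB) (seq_channel (dA * dB) dA \<Psi> js)"
    using assms(3) by (intro is_channel_seq_channel) auto
  show "0 \<le> prod_list (map w js)"
    using js assms(1) by (induction js) auto
qed simp

section \<open>The partial swap channel\<close>

definition select_mat :: "nat \<Rightarrow> nat \<Rightarrow> (nat \<Rightarrow> nat) \<Rightarrow> complex mat" where
  "select_mat m n f = mat m n (\<lambda>(i, j). if j = f i then 1 else 0)"

lemma dim_select_mat [simp]: "dim_row (select_mat m n f) = m" "dim_col (select_mat m n f) = n"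
  by (simp_all add: select_mat_def)

lemma select_mat_mult_index:
  assumes "dim_row Y = n" "i < m" "f i < n" "k < dim_col Y"
  shows "(select_mat m n f * Y) $$ (i, k) = Y $$ (f i, k)"
proof -
  have "(select_mat m n f * Y) $$ (i, k) = (\<Sum>l<n. (if l = f i then 1 else 0) * Y $$ (l, k))"
    using assms by (simp add: index_mult_mat_sum select_mat_def)
  also have "\<dots> = (\<Sum>l<n. if l = f i then Y $$ (l, k) else 0)"
    by (rule sum.cong) auto
  finally show ?thesis
    using assms by simp
qed

lemma mult_adj_select_mat_index:
  assumes "dim_col Y = n" "i < m" "f i < n" "k < dim_row Y"
  shows "(Y * adj (select_mat m n f)) $$ (k, i) = Y $$ (k, f i)"
proof -
  have "Y * adj (select_mat m n f) = adj (select_mat m n f * adj Y)"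
    using assms by (simp add: adj_mult)
  then show ?thesis
    using assms by (simp add: select_mat_mult_index)
qed

lemma combine_index_less: "i < n \<Longrightarrow> a < d \<Longrightarrow> i * d + a < n * d" for i n a d :: nat
  using mult_le_mono1[of "Suc i" n d] by simp

definition discard_channel :: "nat \<Rightarrow> nat \<Rightarrow> complex mat list" where
  "discard_channel N d = map (\<lambda>a. select_mat N (N * d) (\<lambda>i. i * d + a)) [0..<d]"

lemma is_channel_discard_channel: "is_channel (N * d) N (discard_channel N d)"
  unfolding is_channel_iff_msum
proof
  show "\<forall>K \<in> set (discard_channel N d). K \<in> carrier_mat N (N * d)"
    by (auto simp: discard_channel_def)
  show "msum (N * d) (N * d) (\<lambda>K. adj K * K) (discard_channel N d) = 1\<^sub>m (N * d)"
  proof (rule eq_matI)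
    fix k l assume "k < dim_row (1\<^sub>m (N * d) :: complex mat)" "l < dim_col (1\<^sub>m (N * d) :: complex mat)"
    then have kl: "k < N * d" "l < N * d" by auto
    let ?g = "\<lambda>m. if m = k then if m = l then 1 else 0 else 0 :: complex"
    have "msum (N * d) (N * d) (\<lambda>K. adj K * K) (discard_channel N d) $$ (k, l) =
      (\<Sum>a<d. \<Sum>i<N. ?g (i * d + a))"
      using kl unfolding discard_channel_def msum_map
      by (auto simp: msum_upt_index index_mult_mat_sum select_mat_def intro!: sum.cong)
    also have "\<dots> = (\<Sum>i<N. \<Sum>a<d. ?g (i * d + a))"
      by (rule sum.swap)
    also have "\<dots> = (\<Sum>m<N * d. ?g (m div d * d + m mod d))"
      by (rule sum_div_mod[symmetric])
    also have "\<dots> = 1\<^sub>m (N * d) $$ (k, l)"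
      using kl by simp
    finally show "msum (N * d) (N * d) (\<lambda>K. adj K * K) (discard_channel N d) $$ (k, l) =
      1\<^sub>m (N * d) $$ (k, l)" .
  qed simp_all
qed

lemma apply_discard_channel_index:
  assumes "dim_row Y = N * d" "dim_col Y = N * d" "i < N" "j < N"
  shows "apply_channel N (discard_channel N d) Y $$ (i, j) = (\<Sum>a<d. Y $$ (i * d + a, j * d + a))"
  using assms unfolding apply_channel_eq_msum discard_channel_def msum_map
  by (auto simp: msum_upt_index mult_adj_select_mat_index
      select_mat_mult_index combine_index_less intro!: sum.cong)

lemma apply_discard_channel_kron:
  assumes "X \<in> carrier_mat N N" "\<rho> \<in> carrier_mat d d" "mtrace \<rho> = 1"
  shows "apply_channel N (discard_channel N d) (kron X \<rho>) = X"
proof (rule eq_matI)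
  fix i j assume "i < dim_row X" "j < dim_col X"
  then have ij: "i < N" "j < N" using assms by auto
  have "apply_channel N (discard_channel N d) (kron X \<rho>) $$ (i, j) = (\<Sum>a<d. X $$ (i, j) * \<rho> $$ (a, a))"
    using assms ij by (subst apply_discard_channel_index) (auto simp: kron_index combine_index_less)
  then show "apply_channel N (discard_channel N d) (kron X \<rho>) $$ (i, j) = X $$ (i, j)"
    using assms(2,3) by (simp add: mtrace_carrier flip: sum_distrib_left)
qed (use assms in auto)

text \<open>On \<open>A \<otimes> B \<otimes> A'\<close> the swap of \<open>A\<close> and \<open>A'\<close> exchanges the leading and the trailing digit of an
  index \<open>(a d\<^sub>B + b) d\<^sub>A + a'\<close>.\<close>

definition swap_index :: "nat \<Rightarrow> nat \<Rightarrow> nat \<Rightarrow> nat" where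
  "swap_index dA dB m = (m mod dA * dB + m div dA mod dB) * dA + m div dA div dB"

lemma swap_index_combine:
  "a < dA \<Longrightarrow> swap_index dA dB (i * dA + a) = (a * dB + i mod dB) * dA + i div dB"
  by (simp add: swap_index_def)

lemma swap_index_less:
  assumes "m < dA * dB * dA"
  shows "swap_index dA dB m < dA * dB * dA"
  using div_mod_less[OF assms] div_mod_less[of "m div dA" dA dB] unfolding swap_index_def
  by (intro combine_index_less) auto

lemma swap_index_involutive:
  assumes "m < dA * dB * dA"
  shows "swap_index dA dB (swap_index dA dB m) = m"
proof -
  have "m div dA < dA * dB"
    using assms by (rule div_mod_less)
  then have "m div dA div dB < dA" "m div dA mod dB < dB"
    by (rule div_mod_less)+
  then show ?thesis
    unfolding swap_index_def[of _ _ m] by (simp add: swap_index_combine)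
qed

definition swap_mat :: "nat \<Rightarrow> nat \<Rightarrow> complex mat" where
  "swap_mat dA dB = select_mat (dA * dB * dA) (dA * dB * dA) (swap_index dA dB)"

lemma dim_swap_mat [simp]:
  "dim_row (swap_mat dA dB) = dA * dB * dA" "dim_col (swap_mat dA dB) = dA * dB * dA"
  by (simp_all add: swap_mat_def)

lemma adj_swap_mat: "adj (swap_mat dA dB) = swap_mat dA dB"
proof (rule eq_matI)
  fix i j assume "i < dim_row (swap_mat dA dB)" "j < dim_col (swap_mat dA dB)"
  then have "i = swap_index dA dB j \<longleftrightarrow> j = swap_index dA dB i" "i < dA * dB * dA" "j < dA * dB * dA"
    using swap_index_involutive[of i dA dB] swap_index_involutive[of j dA dB] by auto
  then show "adj (swap_mat dA dB) $$ (i, j) = swap_mat dA dB $$ (i, j)"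
    by (simp add: swap_mat_def select_mat_def)
qed auto

lemma swap_mat_squared: "swap_mat dA dB * swap_mat dA dB = 1\<^sub>m (dA * dB * dA)"
proof (rule eq_matI)
  fix i j
  assume "i < dim_row (1\<^sub>m (dA * dB * dA) :: complex mat)"
    "j < dim_col (1\<^sub>m (dA * dB * dA) :: complex mat)"
  then have ij: "i < dA * dB * dA" "j < dA * dB * dA" by auto
  have "(swap_mat dA dB * swap_mat dA dB) $$ (i, j) = swap_mat dA dB $$ (swap_index dA dB i, j)"
    unfolding swap_mat_def using ij by (intro select_mat_mult_index) (auto simp: swap_index_less)
  also have "\<dots> = 1\<^sub>m (dA * dB * dA) $$ (i, j)"
    using ij by (simp add: swap_mat_def select_mat_def swap_index_less swap_index_involutive)
  finally show "(swap_mat dA dB * swap_mat dA dB) $$ (i, j) = 1\<^sub>m (dA * dB * dA) $$ (i, j)" .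
qed auto

lemma kron_one_mult_index:
  assumes "X \<in> carrier_mat (d * m) k" "\<rho> \<in> carrier_mat d d" "i < d * m" "j < k"
  shows "(kron \<rho> (1\<^sub>m m) * X) $$ (i, j) = (\<Sum>a<d. \<rho> $$ (i div m, a) * X $$ (a * m + i mod m, j))"
proof -
  note i = div_mod_less[OF assms(3)]
  let ?g = "\<lambda>a b. \<rho> $$ (i div m, a) * (if b = i mod m then X $$ (a * m + b, j) else 0)"
  have "(kron \<rho> (1\<^sub>m m) * X) $$ (i, j) = (\<Sum>l<d * m. ?g (l div m) (l mod m))"
    using assms i
    by (auto simp: index_mult_mat_sum kron_index div_mod_less intro!: sum.cong, metis div_mult_mod_eq)
  also have "\<dots> = (\<Sum>a<d. \<Sum>b<m. ?g a b)"
    by (rule sum_div_mod)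
  finally show ?thesis
    using i by (simp flip: sum_distrib_left)
qed

lemma discard_swap_mult:
  assumes X: "X \<in> carrier_mat (dA * dB) (dA * dB)" and \<rho>: "\<rho> \<in> carrier_mat dA dA"
  shows "apply_channel (dA * dB) (discard_channel (dA * dB) dA) (swap_mat dA dB * kron X \<rho>) =
    kron \<rho> (1\<^sub>m dB) * X"
proof (rule eq_matI)
  let ?N = "dA * dB"
  fix i j assume "i < dim_row (kron \<rho> (1\<^sub>m dB) * X)" "j < dim_col (kron \<rho> (1\<^sub>m dB) * X)"
  then have ij: "i < ?N" "j < ?N" using X \<rho> by auto
  note i = div_mod_less[OF ij(1)]
  have "(swap_mat dA dB * kron X \<rho>) $$ (i * dA + a, j * dA + a) =
    \<rho> $$ (i div dB, a) * X $$ (a * dB + i mod dB, j)"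
    if a: "a < dA" for a
  proof -
    note less = combine_index_less[OF ij(1) a] combine_index_less[OF ij(2) a]
    have "(swap_mat dA dB * kron X \<rho>) $$ (i * dA + a, j * dA + a) =
      kron X \<rho> $$ (swap_index dA dB (i * dA + a), j * dA + a)"
      unfolding swap_mat_def using X \<rho> less swap_index_less[OF less(1)]
      by (intro select_mat_mult_index) auto
    then show ?thesis
      using X \<rho> a i less combine_index_less[OF combine_index_less[OF a i(2)] i(1)]
      by (simp add: swap_index_combine kron_index)
  qed
  then show "apply_channel ?N (discard_channel ?N dA) (swap_mat dA dB * kron X \<rho>) $$ (i, j) =
    (kron \<rho> (1\<^sub>m dB) * X) $$ (i, j)"
    using X \<rho> ij by (simp add: apply_discard_channel_index kron_one_mult_index)
qed (use X \<rho> in auto)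

lemma discard_mult_swap:
  assumes X: "X \<in> carrier_mat (dA * dB) (dA * dB)" and \<rho>: "\<rho> \<in> carrier_mat dA dA"
  shows "apply_channel (dA * dB) (discard_channel (dA * dB) dA) (kron X \<rho> * swap_mat dA dB) =
    X * kron \<rho> (1\<^sub>m dB)"
proof -
  have "kron X \<rho> * swap_mat dA dB = adj (swap_mat dA dB * kron (adj X) (adj \<rho>))"
    using X \<rho> by (simp add: adj_mult adj_swap_mat adj_kron)
  then show ?thesis
    using X \<rho> discard_swap_mult[of "adj X" dA dB "adj \<rho>"]
      adj_apply_channel[OF is_channel_discard_channel,
        of "swap_mat dA dB * kron (adj X) (adj \<rho>)" "dA * dB" dA]
    by (simp add: adj_mult adj_kron)
qed

lemma unitary_swap_combination:
  assumes "(cmod \<alpha>)\<^sup>2 + (cmod \<beta>)\<^sup>2 = 1" "Re (cnj \<alpha> * \<beta>) = 0"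
  shows "unitary (dA * dB * dA) (\<alpha> \<cdot>\<^sub>m 1\<^sub>m (dA * dB * dA) + \<beta> \<cdot>\<^sub>m swap_mat dA dB)"
proof (rule unitaryI)
  let ?S = "swap_mat dA dB" and ?I = "1\<^sub>m (dA * dB * dA) :: complex mat"
  have diag: "cnj \<alpha> * \<alpha> + cnj \<beta> * \<beta> = 1"
    using assms(1) by (metis complex_norm_square mult.commute of_real_1 of_real_add)
  have off_diag: "cnj \<alpha> * \<beta> + cnj \<beta> * \<alpha> = 0"
    using assms(2) by (simp add: complex_eq_iff mult.commute)
  have "adj (\<alpha> \<cdot>\<^sub>m ?I + \<beta> \<cdot>\<^sub>m ?S) * (\<alpha> \<cdot>\<^sub>m ?I + \<beta> \<cdot>\<^sub>m ?S) =
      (cnj \<alpha> * \<alpha> + cnj \<beta> * \<beta>) \<cdot>\<^sub>m ?I + (cnj \<alpha> * \<beta> + cnj \<beta> * \<alpha>) \<cdot>\<^sub>m ?S"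
    by (simp add: adj_linear adj_swap_mat mat_mult_distribs swap_mat_squared)
        (auto simp: algebra_simps intro!: eq_matI)
  then show "adj (\<alpha> \<cdot>\<^sub>m ?I + \<beta> \<cdot>\<^sub>m ?S) * (\<alpha> \<cdot>\<^sub>m ?I + \<beta> \<cdot>\<^sub>m ?S) = ?I"
    unfolding diag off_diag by (auto intro!: eq_matI)
qed auto

definition partial_swap :: "nat \<Rightarrow> nat \<Rightarrow> complex \<Rightarrow> complex \<Rightarrow> complex mat list" where
  "partial_swap dA dB \<alpha> \<beta> =
    channel_comp (discard_channel (dA * dB) dA) [\<alpha> \<cdot>\<^sub>m 1\<^sub>m (dA * dB * dA) + \<beta> \<cdot>\<^sub>m swap_mat dA dB]"

lemma is_channel_partial_swap:
  assumes "(cmod \<alpha>)\<^sup>2 + (cmod \<beta>)\<^sup>2 = 1" "Re (cnj \<alpha> * \<beta>) = 0"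
  shows "is_channel (dA * dB * dA) (dA * dB) (partial_swap dA dB \<alpha> \<beta>)"
  unfolding partial_swap_def
  using is_channel_unitary[OF unitary_swap_combination[OF assms]] is_channel_discard_channel
  by (rule is_channel_comp)

lemma apply_partial_swap:
  assumes norm: "(cmod \<alpha>)\<^sup>2 + (cmod \<beta>)\<^sup>2 = 1" "Re (cnj \<alpha> * \<beta>) = 0"
    and X: "X \<in> carrier_mat (dA * dB) (dA * dB)" and \<rho>: "\<rho> \<in> carrier_mat dA dA" "mtrace \<rho> = 1"
  shows "apply_channel (dA * dB) (partial_swap dA dB \<alpha> \<beta>) (kron X \<rho>) =
    (\<alpha> * cnj \<alpha>) \<cdot>\<^sub>m X + (\<beta> * cnj \<alpha>) \<cdot>\<^sub>m (kron \<rho> (1\<^sub>m dB) * X) + (\<alpha> * cnj \<beta>) \<cdot>\<^sub>m (X * kron \<rho> (1\<^sub>m dB))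
    + (\<beta> * cnj \<beta>) \<cdot>\<^sub>m apply_channel (dA * dB) (partial_swap dA dB 0 1) (kron X \<rho>)"
proof -
  let ?N = "dA * dB" and ?S = "swap_mat dA dB" and ?Z = "kron X \<rho>"
  let ?M = "\<lambda>\<alpha> \<beta>. \<alpha> \<cdot>\<^sub>m 1\<^sub>m (dA * dB * dA) + \<beta> \<cdot>\<^sub>m ?S"
  let ?D = "apply_channel ?N (discard_channel ?N dA)"
  have apply_eq: "apply_channel ?N (partial_swap dA dB \<alpha> \<beta>) ?Z = ?D (?M \<alpha> \<beta> * ?Z * adj (?M \<alpha> \<beta>))"
    if "(cmod \<alpha>)\<^sup>2 + (cmod \<beta>)\<^sup>2 = 1" "Re (cnj \<alpha> * \<beta>) = 0" for \<alpha> \<beta>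
    unfolding partial_swap_def using unitary_swap_combination[OF that, of dA dB] X \<rho>
    by (subst apply_channel_comp[OF is_channel_unitary is_channel_discard_channel])
      (auto simp: apply_channel_unitary)
  have expand: "?M \<alpha> \<beta> * ?Z * adj (?M \<alpha> \<beta>) = (\<alpha> * cnj \<alpha>) \<cdot>\<^sub>m ?Z + (\<beta> * cnj \<alpha>) \<cdot>\<^sub>m (?S * ?Z)
      + (\<alpha> * cnj \<beta>) \<cdot>\<^sub>m (?Z * ?S) + (\<beta> * cnj \<beta>) \<cdot>\<^sub>m (?S * ?Z * ?S)" for \<alpha> \<beta>
    using X \<rho>
    by (simp add: adj_linear adj_swap_mat mat_mult_distribs)
      (auto simp: algebra_simps intro!: eq_matI)
  have "?M 0 1 * ?Z * adj (?M 0 1) = ?S * ?Z * ?S"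
    using X \<rho> unfolding expand by (auto intro!: eq_matI)
  then have swapped: "apply_channel ?N (partial_swap dA dB 0 1) ?Z = ?D (?S * ?Z * ?S)"
    using apply_eq[of 0 1] by simp
  show ?thesis
    unfolding swapped unfolding apply_eq[OF norm] expand using X \<rho>
    by (simp add: apply_channel_add[OF is_channel_discard_channel]
        apply_channel_smult[OF is_channel_discard_channel]
        apply_discard_channel_kron discard_swap_mult discard_mult_swap)
qed

section \<open>Unitary evolution\<close>

lemma spectral_mat_one:
  assumes "unitary n V" "\<And>i. i < n \<Longrightarrow> f i = 1"
  shows "spectral_mat V f = 1\<^sub>m n"
proof -
  have "spectral_mat V f = spectral_mat V (\<lambda>_. 1)"
    using assms unitary_carrier[OF assms(1)] by (intro spectral_mat_cong[of _ n]) auto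
  then show ?thesis
    using unitary_carrier[OF assms(1)] by (simp add: spectral_mat_def unitary_inverse[OF assms(1)])
qed

lemma smult_spectral_mat: "a \<cdot>\<^sub>m spectral_mat V f = spectral_mat V (\<lambda>i. a * f i)"
  by (rule eq_matI) (simp_all add: spectral_mat_index sum_distrib_left mult_ac)

lemma spectral_mat_add: "spectral_mat V f + spectral_mat V g = spectral_mat V (\<lambda>i. f i + g i)"
  by (rule eq_matI) (simp_all add: spectral_mat_index sum.distrib algebra_simps)

lemma spectral_mat_pow:
  assumes "unitary n V"
  shows "spectral_mat V f ^\<^sub>m k = spectral_mat V (\<lambda>i. f i ^ k)"
proof (induction k)
  case 0
  show ?case
    using unitary_carrier[OF assms] by (simp add: spectral_mat_one[OF assms])
qed (simp add: spectral_mat_mult[OF assms] mult.commute)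

lemma unitary_spectral_mat:
  assumes "unitary n V" "\<And>i. i < n \<Longrightarrow> cmod (f i) = 1"
  shows "unitary n (spectral_mat V f)"
proof (rule unitaryI)
  have "cnj (f i) * f i = 1" if "i < n" for i
    using complex_norm_square[of "f i"] assms(2)[OF that] by (simp add: mult.commute)
  then show "adj (spectral_mat V f) * spectral_mat V f = 1\<^sub>m n"
    unfolding adj_spectral_mat spectral_mat_mult[OF assms(1)] by (rule spectral_mat_one[OF assms(1)])
qed (use unitary_carrier[OF assms(1)] in auto)

lemma mexp_spectral_mat:
  assumes "unitary n V"
  shows "mexp (spectral_mat V f) = spectral_mat V (\<lambda>i. exp (f i))"
proof (rule eq_matI)
  fix i j
  assume "i < dim_row (spectral_mat V (\<lambda>i. exp (f i)))" "j < dim_col (spectral_mat V (\<lambda>i. exp (f i)))"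
  then have ij: "i < dim_row V" "j < dim_row V" by auto
  have "(\<lambda>k. f l ^ k / of_nat (fact k)) sums exp (f l)" for l
    using exp_converges[of "f l"] by (simp add: scaleR_conv_of_real field_simps)
  then have "(\<lambda>k. \<Sum>l<dim_col V. V $$ (i, l) * (f l ^ k / of_nat (fact k)) * cnj (V $$ (j, l)))
      sums (\<Sum>l<dim_col V. V $$ (i, l) * exp (f l) * cnj (V $$ (j, l)))"
    by (intro sums_sum sums_mult sums_mult2)
  moreover have "(\<Sum>l<dim_col V. V $$ (i, l) * (f l ^ k / of_nat (fact k)) * cnj (V $$ (j, l))) =
      (spectral_mat V f ^\<^sub>m k) $$ (i, j) / of_nat (fact k)" for k
    using ij by (simp add: spectral_mat_pow[OF assms] spectral_mat_index sum_divide_distrib)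
  ultimately have "(\<lambda>k. (spectral_mat V f ^\<^sub>m k) $$ (i, j) / of_nat (fact k)) sums
      spectral_mat V (\<lambda>i. exp (f i)) $$ (i, j)"
    using ij by (simp add: spectral_mat_index)
  then show "mexp (spectral_mat V f) $$ (i, j) = spectral_mat V (\<lambda>i. exp (f i)) $$ (i, j)"
    using ij by (simp add: mexp_def sums_unique[symmetric])
qed (simp_all add: mexp_def)

definition evolution :: "nat \<Rightarrow> complex mat \<Rightarrow> real \<Rightarrow> complex mat" where
  "evolution dB H t = kron (mexp ((- \<i> * complex_of_real t) \<cdot>\<^sub>m H)) (1\<^sub>m dB)"

lemma evolution_spectral_mat:
  assumes "unitary d V"
  shows "evolution dB (spectral_mat V (\<lambda>i. of_real (l i))) t =
    spectral_mat (kron V (1\<^sub>m dB)) (\<lambda>i. exp (- \<i> * of_real (t * l (i div dB))))"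
  by (simp add: evolution_def smult_spectral_mat mexp_spectral_mat[OF assms]
    kron_spectral_mat_one mult.assoc)

context
  fixes d dB :: nat and H :: "complex mat"
  assumes H: "H \<in> carrier_mat d d" "adj H = H"
begin

lemma unitary_evolution: "unitary (d * dB) (evolution dB H t)"
proof -
  obtain V and l :: "nat \<Rightarrow> real" where V: "unitary d V" and Hl: "H = spectral_mat V (\<lambda>i. of_real (l i))"
    using hermitian_spectral[OF H] .
  show ?thesis
    unfolding Hl evolution_spectral_mat[OF V]
    by (intro unitary_spectral_mat unitary_kron V unitary_one) (simp add: norm_exp_eq_Re)
qed

lemma evolution_pow: "evolution dB H t ^\<^sub>m n = evolution dB H (real n * t)"
proof -
  obtain V and l :: "nat \<Rightarrow> real" where V: "unitary d V" and Hl: "H = spectral_mat V (\<lambda>i. of_real (l i))"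
    using hermitian_spectral[OF H] .
  show ?thesis
    unfolding Hl evolution_spectral_mat[OF V] spectral_mat_pow[OF unitary_kron[OF V unitary_one]]
    by (simp add: exp_of_nat_mult[symmetric] mult_ac)
qed

end

section \<open>The linear combination of the sampled states\<close>

lemma dim_ham [simp]: "dim_row (ham d K c \<rho>) = d" "dim_col (ham d K c \<rho>) = d"
  by (simp_all add: ham_def)

lemma ham_eq_msum:
  assumes "\<And>j. j < K \<Longrightarrow> dim_row (\<rho> j) = d" "\<And>j. j < K \<Longrightarrow> dim_col (\<rho> j) = d"
  shows "ham d K c \<rho> = msum d d (\<lambda>j. of_real (c j) \<cdot>\<^sub>m \<rho> j) [0..<K]"
  using assms
  by (auto simp: ham_def msum_upt_index intro!: eq_matI sum.cong)

lemma ham_hermitian: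
  assumes "\<And>j. j < K \<Longrightarrow> density d (\<rho> j)"
  shows "adj (ham d K c \<rho>) = ham d K c \<rho>"
proof -
  note \<rho> = densityD[OF assms]
  have dims: "\<And>j. j < K \<Longrightarrow> dim_row (\<rho> j) = d" "\<And>j. j < K \<Longrightarrow> dim_col (\<rho> j) = d"
    using \<rho>(1) by auto
  show ?thesis
    by (simp add: ham_eq_msum dims, subst adj_msum)
      (auto simp: dims adj_linear psd_hermitian[OF \<rho>(2,1)] intro!: msum_cong)
qed

lemma conj_ham_diag_index:
  assumes V: "V \<in> carrier_mat d d" and i: "i < d"
    and \<rho>: "\<And>j. j < K \<Longrightarrow> dim_row (\<rho> j) = d" "\<And>j. j < K \<Longrightarrow> dim_col (\<rho> j) = d"
  shows "(adj V * ham d K c \<rho> * V) $$ (i, i) = (\<Sum>j<K. of_real (c j) * (adj V * \<rho> j * V) $$ (i, i))"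
proof -
  have "adj V * ham d K c \<rho> * V = msum d d (\<lambda>j. adj V * (of_real (c j) \<cdot>\<^sub>m \<rho> j)) [0..<K] * V"
    using V by (simp add: ham_eq_msum \<rho>, subst mult_msum) (auto simp: \<rho>)
  also have "\<dots> = msum d d (\<lambda>j. of_real (c j) \<cdot>\<^sub>m (adj V * \<rho> j * V)) [0..<K]"
    using V by (subst msum_mult) (auto simp: \<rho> mat_mult_distribs intro!: msum_cong)
  finally show ?thesis
    using V i by (simp add: msum_upt_index)
qed

lemma ham_spectral:
  assumes "\<And>j. j < K \<Longrightarrow> density d (\<rho> j)"
  obtains V and l :: "nat \<Rightarrow> real"
  where "unitary d V" "ham d K c \<rho> = spectral_mat V (\<lambda>i. of_real (l i))"
    "\<And>i. i < d \<Longrightarrow> \<bar>l i\<bar> \<le> (\<Sum>j<K. \<bar>c j\<bar>)"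
proof -
  obtain V and l :: "nat \<Rightarrow> real"
    where V: "unitary d V" and H: "ham d K c \<rho> = spectral_mat V (\<lambda>i. of_real (l i))"
    using hermitian_spectral[OF carrier_matI[OF dim_ham] ham_hermitian[OF assms]] .
  have dims: "\<And>j. j < K \<Longrightarrow> dim_row (\<rho> j) = d" "\<And>j. j < K \<Longrightarrow> dim_col (\<rho> j) = d"
    using densityD(1)[OF assms] by auto
  have "\<bar>l i\<bar> \<le> (\<Sum>j<K. \<bar>c j\<bar>)" if i: "i < d" for i
  proof -
    let ?r = "\<lambda>j. (adj V * \<rho> j * V) $$ (i, i)"
    have "complex_of_real (l i) = (adj V * ham d K c \<rho> * V) $$ (i, i)"
      using i by (simp add: H unitary_conj_spectral_mat[OF V]) (simp add: mat_diag_def)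
    also have "\<dots> = (\<Sum>j<K. of_real (c j) * ?r j)"
      by (rule conj_ham_diag_index[OF unitary_carrier[OF V] i dims])
    finally have "\<bar>l i\<bar> = cmod (\<Sum>j<K. of_real (c j) * ?r j)"
      by (metis norm_of_real)
    also have "\<dots> \<le> (\<Sum>j<K. \<bar>c j\<bar> * cmod (?r j))"
      by (rule sum_norm_le) (simp add: norm_mult)
    also have "\<dots> \<le> (\<Sum>j<K. \<bar>c j\<bar>)"
    proof (rule sum_mono)
      fix j assume "j \<in> {..<K}"
      then have "density d (adj V * \<rho> j * V)"
        using density_unitary_conj[OF unitary_adj[OF V] assms] by simp
      then have "cmod (?r j) \<le> 1"
        using density_diag_le_1[OF _ i] by (simp add: less_eq_complex_def cmod_eq_Re)
      then show "\<bar>c j\<bar> * cmod (?r j) \<le> \<bar>c j\<bar>"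
        by (simp add: mult_left_le)
    qed
    finally show ?thesis .
  qed
  with V H that show thesis by blast
qed

lemma evolution_eq_one:
  assumes \<rho>: "\<And>j. j < K \<Longrightarrow> density d (\<rho> j)" and zero: "(\<Sum>j<K. \<bar>c j\<bar>) * t = 0"
  shows "evolution dB (ham d K c \<rho>) t = 1\<^sub>m (d * dB)"
proof -
  obtain V and l :: "nat \<Rightarrow> real" where V: "unitary d V"
    and H: "ham d K c \<rho> = spectral_mat V (\<lambda>i. of_real (l i))" and l: "\<And>i. i < d \<Longrightarrow> \<bar>l i\<bar> \<le> (\<Sum>j<K. \<bar>c j\<bar>)"
    by (rule ham_spectral[where K = K and d = d and \<rho> = \<rho> and c = c]) (use \<rho> in blast)+
  have "t * l (i div dB) = 0" if "i < d * dB" for i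
    using l[OF div_mod_less(1)[OF that]] zero by auto
  then show ?thesis
    unfolding H evolution_spectral_mat[OF V]
    by (intro spectral_mat_one unitary_kron V unitary_one)
      (simp only: of_real_0 mult_zero_right exp_zero)
qed

section \<open>Error estimates\<close>

lemma norm_exp_minus_linear_le: "cmod (exp (- \<i> * of_real a) - 1 + \<i> * of_real a) \<le> a\<^sup>2"
proof -
  have sin: "\<bar>sin a - a\<bar> \<le> a\<^sup>2 / 2"
    using Maclaurin_sin_bound[of a 2] by (simp add: numeral_2_eq_2 sin_coeff_def)
  have "(sin (a / 2))\<^sup>2 \<le> (a / 2)\<^sup>2"
    using abs_sin_x_le_abs_x[of "a / 2"] by (simp only: abs_le_square_iff)
  then have cos: "\<bar>1 - cos a\<bar> \<le> a\<^sup>2 / 2"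
    using cos_double_sin[of "a / 2"] by (simp add: power_divide)
  have "exp (- \<i> * of_real a) - 1 + \<i> * of_real a = of_real (cos a - 1) + \<i> * of_real (a - sin a)"
    using cis_conv_exp[of "- a"] by (simp add: complex_eq_iff)
  also have "cmod \<dots> \<le> \<bar>cos a - 1\<bar> + \<bar>a - sin a\<bar>"
    using norm_triangle_ineq[of "of_real (cos a - 1)" "\<i> * of_real (a - sin a)"]
    by (simp only: norm_mult norm_ii norm_of_real mult_1)
  finally show ?thesis
    using sin cos by linarith
qed

lemma mtrace_spectral_mat_conj_le:
  assumes V: "unitary n V" and S: "density n S" and f: "\<And>i. i < n \<Longrightarrow> cmod (f i) \<le> r"
  shows "Re (mtrace (spectral_mat V f * S * adj (spectral_mat V f))) \<le> r\<^sup>2"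
proof -
  note Vc = unitary_carrier[OF V] and Sc = densityD(1)[OF S]
  define T where "T = adj V * S * V"
  have T: "density n T"
    unfolding T_def using density_unitary_conj[OF unitary_adj[OF V] S] by simp
  note Tc = densityD(1)[OF T]
  define D where "D = mat_diag n f * T * mat_diag n (\<lambda>i. cnj (f i))"
  have Dc: "D \<in> carrier_mat n n"
    using Tc by (auto simp: D_def)
  have "spectral_mat V f * S * adj (spectral_mat V f) = V * D * adj V"
    using Vc Sc by (simp add: D_def T_def spectral_mat_def adj_mult adj_mat_diag mult_mat_assoc)
  then have "mtrace (spectral_mat V f * S * adj (spectral_mat V f)) = mtrace D"
    by (simp only: mtrace_unitary_conj[OF V Dc])
  also have "\<dots> = (\<Sum>i<n. of_real ((cmod (f i))\<^sup>2) * T $$ (i, i))"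
    using Tc index_mat_diag_mult[of _ T _ f]
      index_mult_mat_diag[of _ "mat_diag n f * T" _ "\<lambda>i. cnj (f i)"]
    unfolding complex_norm_square D_def by (simp add: mtrace_def mult_ac)
  also have "\<dots> \<le> (\<Sum>i<n. of_real (r\<^sup>2) * T $$ (i, i))"
  proof (intro sum_mono mult_right_mono)
    fix i assume "i \<in> {..<n}"
    then show "complex_of_real ((cmod (f i))\<^sup>2) \<le> of_real (r\<^sup>2)" "0 \<le> T $$ (i, i)"
      using f[of i] density_diag_le_1(1)[OF T] by (auto simp: less_eq_complex_def intro: power_mono)
  qed
  also have "\<dots> = of_real (r\<^sup>2)"
    using densityD(3)[OF T] Tc by (simp add: mtrace_carrier flip: sum_distrib_left)
  finally show ?thesis
    by (simp add: less_eq_complex_def)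
qed

lemma trace_bound_density_diff:
  assumes "density n X" "density n Y"
  shows "trace_bound n (X - Y) 2"
  using trace_bound_diff[OF trace_bound_psd[OF densityD(2,1)[OF assms(1)]]
      trace_bound_psd[OF densityD(2,1)[OF assms(2)]]]
    densityD(3)[OF assms(1)] densityD(3)[OF assms(2)] by simp

text \<open>With \<open>L = 1 - \<i> A\<close>, \<open>U X U\<^sup>* = L X L\<^sup>* + (R X U\<^sup>* + U X R\<^sup>*) - R X R\<^sup>*\<close>.\<close>

lemma trace_bound_conj_first_order:
  assumes X: "density n X" and U: "unitary n U" and A: "A \<in> carrier_mat n n" "adj A = A"
    and R: "R \<in> carrier_mat n n"
    and U_eq: "U = 1\<^sub>m n - \<i> \<cdot>\<^sub>m A + R" and x: "0 < x" "x \<le> 1"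
    and A_le: "Re (mtrace (A * X * adj A)) \<le> x\<^sup>2" and R_le: "Re (mtrace (R * X * adj R)) \<le> (x\<^sup>2)\<^sup>2"
  shows "trace_bound n (U * X * adj U - (X - \<i> \<cdot>\<^sub>m (A * X - X * A))) (4 * x\<^sup>2)"
proof -
  note Xc = densityD(1)[OF X] and X_psd = densityD(2)[OF X]
  have conj: "trace_bound n (B * X * adj B) r" if "B \<in> carrier_mat n n"
    "Re (mtrace (B * X * adj B)) \<le> r" for B r
    using that Xc by (intro trace_bound_mono[OF trace_bound_psd] psd_conj[OF X_psd Xc]) auto
  have cross: "trace_bound n (R * X * adj U + U * X * adj R) (2 * x\<^sup>2)"
  proof (rule trace_bound_mono)
    show "trace_bound n (R * X * adj U + U * X * adj R)
        (1 / x\<^sup>2 * Re (mtrace (R * X * adj R)) + Re (mtrace (U * X * adj U)) / (1 / x\<^sup>2))"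
      using x by (intro trace_bound_cross[OF X_psd Xc R unitary_carrier[OF U]]) simp
    have "Re (mtrace (U * X * adj U)) = 1"
      using densityD(3)[OF density_unitary_conj[OF U X]] by simp
    then show "1 / x\<^sup>2 * Re (mtrace (R * X * adj R)) + Re (mtrace (U * X * adj U)) / (1 / x\<^sup>2) \<le> 2 * x\<^sup>2"
      using R_le x by (simp add: divide_le_eq power2_eq_square)
  qed
  have "(x\<^sup>2)\<^sup>2 \<le> x\<^sup>2"
    using x by (simp add: power2_eq_square mult_le_one mult_left_le)
  then have "Re (mtrace (R * X * adj R)) \<le> x\<^sup>2"
    using R_le by linarith
  then have "trace_bound n (A * X * adj A + (R * X * adj U + U * X * adj R) - R * X * adj R)
    (x\<^sup>2 + 2 * x\<^sup>2 + x\<^sup>2)"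
    by (intro trace_bound_add trace_bound_diff conj cross A R A_le)
  moreover have "U * X * adj U - (X - \<i> \<cdot>\<^sub>m (A * X - X * A)) =
      A * X * adj A + (R * X * adj U + U * X * adj R) - R * X * adj R"
    unfolding U_eq using A R Xc
    by (simp add: adj_linear mat_mult_distribs) (auto simp: algebra_simps intro!: eq_matI)
  ultimately show ?thesis
    by simp
qed

lemma trace_bound_conj_exp_first_order:
  assumes W: "unitary n W" and a: "\<And>i. i < n \<Longrightarrow> \<bar>a i\<bar> \<le> x" and x: "0 < x" "x \<le> 1" and X: "density n X"
  defines "A \<equiv> spectral_mat W (\<lambda>i. of_real (a i))"
  defines "U \<equiv> spectral_mat W (\<lambda>i. exp (- \<i> * of_real (a i)))"
  shows "trace_bound n (U * X * adj U - (X - \<i> \<cdot>\<^sub>m (A * X - X * A))) (4 * x\<^sup>2)"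
proof (rule trace_bound_conj_first_order[OF X])
  define R where "R = spectral_mat W (\<lambda>i. exp (- \<i> * of_real (a i)) - 1 + \<i> * of_real (a i))"
  note Wc = unitary_carrier[OF W]
  show "unitary n U"
    unfolding U_def by (rule unitary_spectral_mat[OF W]) (simp add: norm_exp_eq_Re)
  show A: "A \<in> carrier_mat n n" "adj A = A" and R: "R \<in> carrier_mat n n"
    using Wc by (auto simp: A_def R_def adj_spectral_mat)
  have one: "1\<^sub>m n = spectral_mat W (\<lambda>_. 1)"
    by (rule spectral_mat_one[OF W, symmetric]) simp
  have "U = 1\<^sub>m n + (- \<i>) \<cdot>\<^sub>m A + R"
    unfolding one A_def R_def U_def smult_spectral_mat spectral_mat_add by (simp add: algebra_simps)
  then show "U = 1\<^sub>m n - \<i> \<cdot>\<^sub>m A + R"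
    using A R by (auto intro!: eq_matI)
  show "Re (mtrace (A * X * adj A)) \<le> x\<^sup>2"
    unfolding A_def using a by (intro mtrace_spectral_mat_conj_le[OF W X]) simp
  have "(a i)\<^sup>2 \<le> x\<^sup>2" if "i < n" for i
    using a[OF that] by (simp flip: abs_le_square_iff)
  then show "Re (mtrace (R * X * adj R)) \<le> (x\<^sup>2)\<^sup>2"
    unfolding R_def using norm_exp_minus_linear_le order_trans
    by (intro mtrace_spectral_mat_conj_le[OF W X]) blast
qed fact+

lemma evolution_first_order_error:
  assumes V: "unitary d V" and H: "H = spectral_mat V (\<lambda>i. of_real (l i))"
    and l: "\<And>i. i < d \<Longrightarrow> \<bar>l i\<bar> \<le> r"
    and x: "0 < r * \<bar>\<tau>\<bar>" "r * \<bar>\<tau>\<bar> \<le> 1" and X: "density (d * m) X"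
  defines "U \<equiv> evolution m H \<tau>" and "H\<^sub>1 \<equiv> kron H (1\<^sub>m m)"
  shows "trace_bound (d * m) (U * X * adj U - (X - (\<i> * of_real \<tau>) \<cdot>\<^sub>m (H\<^sub>1 * X - X * H\<^sub>1)))
    (4 * (r * \<bar>\<tau>\<bar>)\<^sup>2)"
proof -
  define W where "W = kron V (1\<^sub>m m)"
  define a where "a i = \<tau> * l (i div m)" for i
  define A where "A = spectral_mat W (\<lambda>i. of_real (a i))"
  have W: "unitary (d * m) W"
    unfolding W_def using V unitary_one by (rule unitary_kron)
  have "\<bar>a i\<bar> \<le> r * \<bar>\<tau>\<bar>" if "i < d * m" for i
    using mult_right_mono[OF l[OF div_mod_less(1)[OF that]], of "\<bar>\<tau>\<bar>"]
    by (simp add: a_def abs_mult mult.commute)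
  then have "trace_bound (d * m) (U * X * adj U - (X - \<i> \<cdot>\<^sub>m (A * X - X * A))) (4 * (r * \<bar>\<tau>\<bar>)\<^sup>2)"
    using trace_bound_conj_exp_first_order[OF W _ x X, of a]
    by (simp add: U_def H evolution_spectral_mat[OF V] A_def W_def a_def)
  moreover have "A = of_real \<tau> \<cdot>\<^sub>m H\<^sub>1"
    by (simp add: A_def H\<^sub>1_def H kron_spectral_mat_one smult_spectral_mat W_def a_def)
  then have "\<i> \<cdot>\<^sub>m (A * X - X * A) = (\<i> * of_real \<tau>) \<cdot>\<^sub>m (H\<^sub>1 * X - X * H\<^sub>1)"
    using densityD(1)[OF X] unitary_carrier[OF V]
    by (simp add: H\<^sub>1_def H mat_mult_distribs) (auto simp: algebra_simps intro!: eq_matI)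
  ultimately show ?thesis
    by simp
qed

lemma unitary_pow: "unitary n U \<Longrightarrow> unitary n (U ^\<^sub>m m)"
  using unitary_carrier[of n U] by (induction m) (auto simp: unitary_one unitary_mult)

lemma trace_bound_iterate:
  assumes U: "unitary n U" and F: "\<And>X. density n X \<Longrightarrow> density n (F X)"
    and step: "\<And>X. density n X \<Longrightarrow> trace_bound n (U * X * adj U - F X) e"
    and X: "density n X"
  shows "trace_bound n (U ^\<^sub>m m * X * adj (U ^\<^sub>m m) - (F ^^ m) X) (real m * e)"
  using X
proof (induction m arbitrary: X)
  case 0
  then show ?case
    using densityD(1)[OF 0] unitary_carrier[OF U] by (simp add: trace_bound_zero)
next
  case (Suc m)
  let ?V = "U ^\<^sub>m m"
  note V = unitary_pow[OF U, of m]
  have carriers: "U \<in> carrier_mat n n" "?V \<in> carrier_mat n n" "X \<in> carrier_mat n n"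
    "F X \<in> carrier_mat n n"
    using U V Suc.prems F[OF Suc.prems] by (auto simp: unitary_carrier densityD)
  have FX: "dim_row ((F ^^ m) (F X)) = n" "dim_col ((F ^^ m) (F X)) = n"
    using trace_bound_carrier[OF Suc.IH[OF F[OF Suc.prems]]] by auto
  have "trace_bound n (?V * (U * X * adj U - F X) * adj ?V + (?V * F X * adj ?V - (F ^^ m) (F X)))
      (e + real m * e)"
    by (intro trace_bound_add trace_bound_unitary_conj[OF _ V] step Suc.IH F Suc.prems)
  moreover have "?V * (U * X * adj U - F X) * adj ?V + (?V * F X * adj ?V - (F ^^ m) (F X)) =
      (U ^\<^sub>m Suc m) * X * adj (U ^\<^sub>m Suc m) - (F ^^ Suc m) X"
    using carriers FX
    by (simp add: mat_mult_distribs adj_mult mult_mat_assoc funpow_swap1) (auto intro!: eq_matI)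
  ultimately show ?case
    by (simp add: distrib_right)
qed

section \<open>The simulation protocol\<close>

text \<open>The angle is chosen so that the commutator term of the partial swap has coefficient exactly \<open>x\<close>.\<close>

definition swap_angle :: "real \<Rightarrow> real" where
  "swap_angle x = arcsin (2 * x) / 2"

lemma swap_angle:
  assumes "0 \<le> x" "2 * x \<le> 1"
  shows sin_cos_swap_angle: "sin (swap_angle x) * cos (swap_angle x) = x"
    and sin_swap_angle_squared_le: "(sin (swap_angle x))\<^sup>2 \<le> 2 * x\<^sup>2"
proof -
  let ?\<theta> = "swap_angle x"
  have double: "2 * ?\<theta> = arcsin (2 * x)"
    by (simp add: swap_angle_def)
  have "sin (2 * ?\<theta>) = 2 * x"
    unfolding double using assms by (intro sin_arcsin) auto
  then show "sin ?\<theta> * cos ?\<theta> = x"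
    by (simp add: sin_double)
  define u where "u = 1 - (2 * x)\<^sup>2"
  have u: "0 \<le> u" "u \<le> 1"
    using assms abs_square_le_1[of "2 * x"] by (auto simp: u_def)
  have "cos (2 * ?\<theta>) = sqrt u"
    unfolding double u_def using assms by (intro cos_arcsin) auto
  moreover have "u \<le> sqrt u"
    using u by (intro real_le_rsqrt) (simp add: power2_eq_square mult_left_le)
  ultimately show "(sin ?\<theta>)\<^sup>2 \<le> 2 * x\<^sup>2"
    using cos_double_sin[of ?\<theta>] by (simp add: u_def power_mult_distrib)
qed

definition swap_sign :: "(nat \<Rightarrow> real) \<Rightarrow> real \<Rightarrow> nat \<Rightarrow> real" where
  "swap_sign c t j = (if c j * t \<ge> 0 then 1 else - 1)"

lemma swap_sign_squared: "(swap_sign c t j)\<^sup>2 = 1"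
  by (simp add: swap_sign_def)

lemma swap_sign_abs: "\<bar>c j\<bar> * swap_sign c t j * \<bar>t\<bar> = c j * t"
  by (auto simp: swap_sign_def abs_if not_le zero_le_mult_iff)

definition swap_step :: "nat \<Rightarrow> nat \<Rightarrow> (nat \<Rightarrow> real) \<Rightarrow> real \<Rightarrow> real \<Rightarrow> nat \<Rightarrow> complex mat list" where
  "swap_step dA dB c t \<theta> j =
    partial_swap dA dB (of_real (cos \<theta>)) (- \<i> * of_real (swap_sign c t j * sin \<theta>))"

lemma swap_step_norm:
  "(cmod (of_real (cos \<theta>)))\<^sup>2 + (cmod (- \<i> * of_real (swap_sign c t j * sin \<theta>)))\<^sup>2 = 1"
  "Re (cnj (of_real (cos \<theta>)) * (- \<i> * of_real (swap_sign c t j * sin \<theta>))) = 0"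
  using swap_sign_squared[of c t j] by (simp_all add: norm_mult power_mult_distrib)

lemma is_channel_swap_step: "is_channel (dA * dB * dA) (dA * dB) (swap_step dA dB c t \<theta> j)"
  unfolding swap_step_def by (rule is_channel_partial_swap[OF swap_step_norm])

lemma apply_swap_step:
  assumes X: "X \<in> carrier_mat (dA * dB) (dA * dB)" and \<rho>: "density dA \<rho>"
  shows "apply_channel (dA * dB) (swap_step dA dB c t \<theta> j) (kron X \<rho>) =
    of_real ((cos \<theta>)\<^sup>2) \<cdot>\<^sub>m X
    + of_real ((sin \<theta>)\<^sup>2) \<cdot>\<^sub>m apply_channel (dA * dB) (partial_swap dA dB 0 1) (kron X \<rho>)
    - (\<i> * of_real (swap_sign c t j * (sin \<theta> * cos \<theta>))) \<cdot>\<^sub>m (kron \<rho> (1\<^sub>m dB) * X - X * kron \<rho> (1\<^sub>m dB))"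
proof -
  let ?\<beta> = "- \<i> * complex_of_real (swap_sign c t j * sin \<theta>)"
  have "?\<beta> * cnj ?\<beta> = of_real ((swap_sign c t j)\<^sup>2 * (sin \<theta>)\<^sup>2)"
    by (simp add: power2_eq_square algebra_simps)
  then have \<beta>: "?\<beta> * cnj ?\<beta> = of_real ((sin \<theta>)\<^sup>2)"
    by (simp add: swap_sign_squared)
  show ?thesis
    unfolding swap_step_def apply_partial_swap[OF swap_step_norm X densityD(1,3)[OF \<rho>]] \<beta>
    using X densityD(1)[OF \<rho>] by (intro eq_matI) (auto simp: power2_eq_square algebra_simps)
qed

lemma commutator_kron_ham_index:
  assumes \<rho>: "\<And>j. j < K \<Longrightarrow> dim_row (\<rho> j) = d" "\<And>j. j < K \<Longrightarrow> dim_col (\<rho> j) = d"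
    and X: "X \<in> carrier_mat (d * m) (d * m)" and ik: "i < d * m" "k < d * m"
  shows "(kron (ham d K c \<rho>) (1\<^sub>m m) * X - X * kron (ham d K c \<rho>) (1\<^sub>m m)) $$ (i, k) =
    (\<Sum>j<K. of_real (c j) * (kron (\<rho> j) (1\<^sub>m m) * X - X * kron (\<rho> j) (1\<^sub>m m)) $$ (i, k))"
proof -
  have H: "kron (ham d K c \<rho>) (1\<^sub>m m) =
      msum (d * m) (d * m) (\<lambda>j. of_real (c j) \<cdot>\<^sub>m kron (\<rho> j) (1\<^sub>m m)) [0..<K]"
    by (simp add: ham_eq_msum \<rho>, subst kron_msum_left) (auto simp: \<rho> kron_smult_left)
  have "(kron (ham d K c \<rho>) (1\<^sub>m m) * X) $$ (i, k) =
    (\<Sum>j<K. of_real (c j) * (kron (\<rho> j) (1\<^sub>m m) * X) $$ (i, k))"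
    unfolding H using X ik by (subst msum_mult)
      (auto simp: \<rho> msum_upt_index mat_mult_distribs intro!: sum.cong)
  moreover have "(X * kron (ham d K c \<rho>) (1\<^sub>m m)) $$ (i, k) =
    (\<Sum>j<K. of_real (c j) * (X * kron (\<rho> j) (1\<^sub>m m)) $$ (i, k))"
    unfolding H using X ik by (subst mult_msum)
      (auto simp: \<rho> msum_upt_index mat_mult_distribs intro!: sum.cong)
  ultimately show ?thesis
    using X ik by (auto simp: \<rho> right_diff_distrib simp flip: sum_subtractf intro!: sum.cong)
qed

lemma weighted_swap_step_index:
  assumes X: "X \<in> carrier_mat (dA * dB) (dA * dB)" and \<rho>: "density dA \<rho>"
    and ik: "i < dA * dB" "k < dA * dB"
    and \<tau>: "sin \<theta> * cos \<theta> * (w * swap_sign c t j) = \<tau> * c j"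
  shows "of_real w * apply_channel (dA * dB) (swap_step dA dB c t \<theta> j) (kron X \<rho>) $$ (i, k) =
    of_real w * (of_real ((cos \<theta>)\<^sup>2) * X $$ (i, k))
    + of_real ((sin \<theta>)\<^sup>2) * (of_real w * apply_channel (dA * dB) (partial_swap dA dB 0 1) (kron X \<rho>) $$ (i, k))
    - \<i> * of_real \<tau> * (of_real (c j) * (kron \<rho> (1\<^sub>m dB) * X - X * kron \<rho> (1\<^sub>m dB)) $$ (i, k))"
proof -
  let ?c = "(kron \<rho> (1\<^sub>m dB) * X - X * kron \<rho> (1\<^sub>m dB)) $$ (i, k)"
  have "complex_of_real \<tau> * (of_real (c j) * ?c) = of_real (\<tau> * c j) * ?c"
    by simp
  also have "\<tau> * c j = w * (swap_sign c t j * (sin \<theta> * cos \<theta>))"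
    using \<tau> by (simp add: mult_ac)
  finally have "\<i> * of_real \<tau> * (of_real (c j) * ?c) =
      of_real w * (\<i> * of_real (swap_sign c t j * (sin \<theta> * cos \<theta>)) * ?c)"
    by (simp add: mult_ac)
  moreover have "apply_channel (dA * dB) (swap_step dA dB c t \<theta> j) (kron X \<rho>) $$ (i, k) =
      of_real ((cos \<theta>)\<^sup>2) * X $$ (i, k)
      + of_real ((sin \<theta>)\<^sup>2) * apply_channel (dA * dB) (partial_swap dA dB 0 1) (kron X \<rho>) $$ (i, k)
      - \<i> * of_real (swap_sign c t j * (sin \<theta> * cos \<theta>)) * ?c"
    unfolding apply_swap_step[OF X \<rho>] using X ik densityD(1)[OF \<rho>] by simp
  ultimately show ?thesis
    by (simp only: distrib_left right_diff_distrib mult.left_commute)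
qed

lemma mean_swap_step:
  assumes \<rho>: "\<And>j. j < K \<Longrightarrow> density dA (\<rho> j)" and X: "X \<in> carrier_mat (dA * dB) (dA * dB)"
    and w: "(\<Sum>j<K. w j) = 1" and \<tau>: "\<And>j. sin \<theta> * cos \<theta> * (w j * swap_sign c t j) = \<tau> * c j"
  defines "H \<equiv> kron (ham dA K c \<rho>) (1\<^sub>m dB)"
  shows "mean_step (dA * dB) K w (swap_step dA dB c t \<theta>) \<rho> X =
    of_real ((cos \<theta>)\<^sup>2) \<cdot>\<^sub>m X
    + of_real ((sin \<theta>)\<^sup>2) \<cdot>\<^sub>m mean_step (dA * dB) K w (\<lambda>_. partial_swap dA dB 0 1) \<rho> X
    - (\<i> * of_real \<tau>) \<cdot>\<^sub>m (H * X - X * H)"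
    (is "?L = ?R")
proof (rule eq_matI)
  let ?N = "dA * dB"
  let ?T = "\<lambda>j. apply_channel ?N (partial_swap dA dB 0 1) (kron X (\<rho> j))"
  let ?C = "\<lambda>j. kron (\<rho> j) (1\<^sub>m dB) * X - X * kron (\<rho> j) (1\<^sub>m dB)"
  fix i k assume "i < dim_row ?R" "k < dim_col ?R"
  then have ik: "i < ?N" "k < ?N" using X by (auto simp: H_def)
  let ?x = "of_real ((cos \<theta>)\<^sup>2) * X $$ (i, k)"
  have "?L $$ (i, k) =
    (\<Sum>j<K. of_real (w j) * apply_channel ?N (swap_step dA dB c t \<theta> j) (kron X (\<rho> j)) $$ (i, k))"
    using ik by (simp add: mean_step_def msum_upt_index)
  also have "\<dots> = (\<Sum>j<K. of_real (w j) * ?x + of_real ((sin \<theta>)\<^sup>2) * (of_real (w j) * ?T j $$ (i, k))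
      - \<i> * of_real \<tau> * (of_real (c j) * ?C j $$ (i, k)))"
    by (intro sum.cong refl weighted_swap_step_index X \<rho> ik \<tau>) simp
  also have "\<dots> = of_real (\<Sum>j<K. w j) * ?x + of_real ((sin \<theta>)\<^sup>2) * (\<Sum>j<K. of_real (w j) * ?T j $$ (i, k))
      - \<i> * of_real \<tau> * (\<Sum>j<K. of_real (c j) * ?C j $$ (i, k))"
    by (simp only: sum.distrib sum_subtractf sum_distrib_left sum_distrib_right of_real_sum)
  also have "(\<Sum>j<K. of_real (c j) * ?C j $$ (i, k)) = (H * X - X * H) $$ (i, k)"
    unfolding H_def using densityD(1)[OF \<rho>] X ik by (intro commutator_kron_ham_index[symmetric]) auto
  finally show "?L $$ (i, k) = ?R $$ (i, k)"
    unfolding w using X ik by (simp add: mean_step_def msum_upt_index H_def)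
qed (use X in \<open>auto simp: H_def\<close>)

lemma sum_normalized_abs:
  fixes c :: "nat \<Rightarrow> real"
  assumes "(\<Sum>j<K. \<bar>c j\<bar>) \<noteq> 0"
  shows "(\<Sum>j<K. \<bar>c j\<bar> / (\<Sum>j<K. \<bar>c j\<bar>)) = 1"
  using assms by (simp flip: sum_divide_distrib)

lemma mean_swap_step_error:
  fixes c :: "nat \<Rightarrow> real" and \<tau> :: real
  assumes \<rho>: "\<And>j. j < K \<Longrightarrow> density dA (\<rho> j)" and X: "density (dA * dB) X"
  defines "ctot \<equiv> (\<Sum>j<K. \<bar>c j\<bar>)"
  defines "x \<equiv> ctot * \<bar>\<tau>\<bar>"
  assumes x: "0 < x" "2 * x \<le> 1"
  defines "U \<equiv> evolution dB (ham dA K c \<rho>) \<tau>"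
  shows "trace_bound (dA * dB)
    (U * X * adj U -
      mean_step (dA * dB) K (\<lambda>j. \<bar>c j\<bar> / ctot) (swap_step dA dB c \<tau> (swap_angle x)) \<rho> X) (8 * x\<^sup>2)"
proof -
  let ?N = "dA * dB" and ?w = "\<lambda>j. \<bar>c j\<bar> / ctot" and ?\<theta> = "swap_angle x"
    and ?H = "kron (ham dA K c \<rho>) (1\<^sub>m dB)"
  define T where "T = mean_step ?N K ?w (\<lambda>_. partial_swap dA dB 0 1) \<rho> X"
  have ctot: "ctot > 0"
    using x(1) by (simp add: x_def zero_less_mult_iff)
  have w: "(\<Sum>j<K. ?w j) = 1"
    unfolding ctot_def by (rule sum_normalized_abs) (use ctot in \<open>simp add: ctot_def\<close>)
  obtain V and l :: "nat \<Rightarrow> real" where V: "unitary dA V"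
    and H: "ham dA K c \<rho> = spectral_mat V (\<lambda>i. of_real (l i))" and l: "\<And>i. i < dA \<Longrightarrow> \<bar>l i\<bar> \<le> ctot"
    unfolding ctot_def
    by (rule ham_spectral[where K = K and d = dA and \<rho> = \<rho> and c = c]) (use \<rho> in blast)+
  have first_order: "trace_bound ?N (U * X * adj U - (X - (\<i> * of_real \<tau>) \<cdot>\<^sub>m (?H * X - X * ?H)))
    (4 * x\<^sup>2)"
    unfolding U_def x_def using x
    by (intro evolution_first_order_error[OF V H l _ _ X]) (auto simp: x_def)
  have "density ?N T"
    unfolding T_def using \<rho> X w ctot
    by (intro density_mean_step[of _ _ dA]) (auto intro: is_channel_partial_swap)
  then have second_order: "trace_bound ?N (of_real ((sin ?\<theta>)\<^sup>2) \<cdot>\<^sub>m (X - T)) ((sin ?\<theta>)\<^sup>2 * 2)"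
    using X by (intro trace_bound_smult trace_bound_density_diff) auto
  have mean: "mean_step ?N K ?w (swap_step dA dB c \<tau> ?\<theta>) \<rho> X =
      of_real ((cos ?\<theta>)\<^sup>2) \<cdot>\<^sub>m X + of_real ((sin ?\<theta>)\<^sup>2) \<cdot>\<^sub>m T - (\<i> * of_real \<tau>) \<cdot>\<^sub>m (?H * X - X * ?H)"
    unfolding T_def using sin_cos_swap_angle[of x] x ctot swap_sign_abs[of c _ \<tau>]
    by (intro mean_swap_step[OF \<rho> densityD(1)[OF X] w]) (auto simp: x_def field_simps)
  have "U * X * adj U - mean_step ?N K ?w (swap_step dA dB c \<tau> ?\<theta>) \<rho> X =
      U * X * adj U - (X - (\<i> * of_real \<tau>) \<cdot>\<^sub>m (?H * X - X * ?H)) + of_real ((sin ?\<theta>)\<^sup>2) \<cdot>\<^sub>m (X - T)"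
    unfolding mean cos_squared_eq using densityD(1)[OF X] trace_bound_carrier[OF first_order]
    by (intro eq_matI) (auto simp: T_def algebra_simps)
  then show ?thesis
    using trace_bound_mono[OF trace_bound_add[OF first_order second_order]]
      sin_swap_angle_squared_le[of x] x by simp
qed

text \<open>The junk values \<open>t / 0\<close> and \<open>\<bar>c j\<bar> / 0\<close> occur for \<open>n = 0\<close> only, where no sample is drawn.\<close>

definition sampling_prob :: "nat \<Rightarrow> (nat \<Rightarrow> real) \<Rightarrow> nat list \<Rightarrow> real" where
  "sampling_prob K c js = prod_list (map (\<lambda>j. \<bar>c j\<bar> / (\<Sum>j<K. \<bar>c j\<bar>)) js)"

definition sampling_channel :: "nat \<Rightarrow> nat \<Rightarrow> nat \<Rightarrow> (nat \<Rightarrow> real) \<Rightarrow> real \<Rightarrow> nat \<Rightarrow>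
    nat list \<Rightarrow> complex mat list" where
  "sampling_channel dA dB K c t n =
    seq_channel (dA * dB) dA (swap_step dA dB c (t / n) (swap_angle ((\<Sum>j<K. \<bar>c j\<bar>) * \<bar>t / n\<bar>)))"

lemma valid_sampling_protocol:
  fixes c :: "nat \<Rightarrow> real"
  assumes "n = 0 \<or> (\<Sum>j<K. \<bar>c j\<bar>) \<noteq> 0"
  shows "valid_protocol dA dB K (sample_seqs K n) (sampling_prob K c) (sampling_channel dA dB K c t n)"
  unfolding sampling_prob_def sampling_channel_def using assms sum_normalized_abs[of c K]
  by (intro valid_protocol_sampling is_channel_swap_step) (auto intro: sum_nonneg)

lemma protocol_output_sampling_protocol:
  assumes "\<And>j. j < K \<Longrightarrow> density dA (\<rho> j)" "density (dA * dB) \<sigma>"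
  shows "protocol_output dA dB (sample_seqs K n) (sampling_prob K c)
    (sampling_channel dA dB K c t n) \<rho> \<sigma> =
    (mean_step (dA * dB) K (\<lambda>j. \<bar>c j\<bar> / (\<Sum>j<K. \<bar>c j\<bar>))
      (swap_step dA dB c (t / n) (swap_angle ((\<Sum>j<K. \<bar>c j\<bar>) * \<bar>t / n\<bar>))) \<rho> ^^ n) \<sigma>"
  unfolding sampling_prob_def sampling_channel_def using assms
  by (intro protocol_output_sampling is_channel_swap_step densityD(1))

lemma empty_sampling_error:
  fixes c :: "nat \<Rightarrow> real" and t :: real
  assumes \<rho>: "\<And>j. j < K \<Longrightarrow> density dA (\<rho> j)" and \<sigma>: "density (dA * dB) \<sigma>"
  defines "U \<equiv> evolution dB (ham dA K c \<rho>) t"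
    and "out \<equiv> protocol_output dA dB (sample_seqs K 0) (sampling_prob K c)
      (sampling_channel dA dB K c t 0) \<rho> \<sigma>"
  shows "trace_norm (U * \<sigma> * adj U - out) \<le> 2"
    and "(\<Sum>j<K. \<bar>c j\<bar>) * t = 0 \<Longrightarrow> trace_norm (U * \<sigma> * adj U - out) \<le> 0"
proof -
  have out: "out = \<sigma>"
    unfolding out_def by (subst protocol_output_sampling_protocol) (use \<rho> \<sigma> in auto)
  have "unitary (dA * dB) U"
    unfolding U_def by (rule unitary_evolution[OF carrier_matI[OF dim_ham] ham_hermitian[OF \<rho>]])
  then show "trace_norm (U * \<sigma> * adj U - out) \<le> 2"
    unfolding out using \<sigma> by (intro trace_norm_le trace_bound_density_diff density_unitary_conj)
  show "trace_norm (U * \<sigma> * adj U - out) \<le> 0" if zero: "(\<Sum>j<K. \<bar>c j\<bar>) * t = 0"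
  proof -
    have "U = 1\<^sub>m (dA * dB)"
      unfolding U_def using \<rho> zero by (rule evolution_eq_one)
    then show ?thesis
      using densityD(1)[OF \<sigma>] trace_norm_le[OF trace_bound_zero, of "dA * dB"] by (simp add: out)
  qed
qed

lemma iterated_mean_swap_step_error:
  fixes c :: "nat \<Rightarrow> real" and t :: real and n :: nat
  assumes \<rho>: "\<And>j. j < K \<Longrightarrow> density dA (\<rho> j)" and \<sigma>: "density (dA * dB) \<sigma>"
  defines "x \<equiv> (\<Sum>j<K. \<bar>c j\<bar>) * \<bar>t / n\<bar>"
  assumes n: "n > 0" and x: "0 < x" "2 * x \<le> 1"
  defines "U \<equiv> evolution dB (ham dA K c \<rho>) t"
    and "F \<equiv> mean_step (dA * dB) K (\<lambda>j. \<bar>c j\<bar> / (\<Sum>j<K. \<bar>c j\<bar>))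
      (swap_step dA dB c (t / n) (swap_angle x)) \<rho>"
  shows "trace_bound (dA * dB) (U * \<sigma> * adj U - (F ^^ n) \<sigma>) (real n * (8 * x\<^sup>2))"
proof -
  let ?N = "dA * dB" and ?V = "evolution dB (ham dA K c \<rho>) (t / n)"
  note H = carrier_matI[OF dim_ham] ham_hermitian[OF \<rho>]
  have "trace_bound ?N (?V ^\<^sub>m n * \<sigma> * adj (?V ^\<^sub>m n) - (F ^^ n) \<sigma>) (real n * (8 * x\<^sup>2))"
  proof (rule trace_bound_iterate[OF unitary_evolution[OF H] _ _ \<sigma>])
    fix X assume X: "density ?N X"
    have "(\<Sum>j<K. \<bar>c j\<bar>) \<noteq> 0" "(\<Sum>j<K. \<bar>c j\<bar>) \<ge> 0"
      using x(1) by (auto simp: x_def intro: sum_nonneg)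
    then show "density ?N (F X)"
      unfolding F_def using \<rho> X sum_normalized_abs[of c K]
      by (intro density_mean_step[of _ _ dA] is_channel_swap_step) auto
    show "trace_bound ?N (?V * X * adj ?V - F X) (8 * x\<^sup>2)"
      using x unfolding F_def x_def by (intro mean_swap_step_error \<rho> X)
  qed
  moreover have "?V ^\<^sub>m n = U"
    using n by (simp add: evolution_pow[OF H] U_def)
  ultimately show ?thesis
    by simp
qed

lemma sampling_error:
  fixes c :: "nat \<Rightarrow> real" and t :: real
  assumes \<rho>: "\<And>j. j < K \<Longrightarrow> density dA (\<rho> j)" and \<sigma>: "density (dA * dB) \<sigma>"
  defines "y \<equiv> (\<Sum>j<K. \<bar>c j\<bar>) * t"
  assumes y: "y \<noteq> 0" and n: "2 * \<bar>y\<bar> \<le> real n"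
  defines "U \<equiv> evolution dB (ham dA K c \<rho>) t"
  shows "trace_norm (U * \<sigma> * adj U -
    protocol_output dA dB (sample_seqs K n) (sampling_prob K c)
          (sampling_channel dA dB K c t n) \<rho> \<sigma>) \<le> 8 * y\<^sup>2 / n"
    (is "trace_norm ?D \<le> _")
proof -
  define x where "x = (\<Sum>j<K. \<bar>c j\<bar>) * \<bar>t / n\<bar>"
  have "(\<Sum>j<K. \<bar>c j\<bar>) \<ge> 0"
    by (rule sum_nonneg) simp
  then have x_eq: "x = \<bar>y\<bar> / n"
    by (simp add: x_def y_def abs_mult)
  have n_pos: "n > 0"
    using n y by (cases "n = 0") auto
  then have "0 < x" "2 * x \<le> 1"
    using n y by (auto simp: x_eq divide_simps)
  then have "trace_bound (dA * dB) ?D (real n * (8 * x\<^sup>2))"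
    using iterated_mean_swap_step_error[of K dA \<rho> dB \<sigma> n c t] n_pos \<rho> \<sigma>
    by (simp add: protocol_output_sampling_protocol U_def x_def)
  then have "trace_norm ?D \<le> real n * (8 * x\<^sup>2)"
    by (rule trace_norm_le)
  also have "\<dots> = 8 * y\<^sup>2 / n"
    using n_pos by (simp add: x_eq power_divide) (simp add: power2_eq_square)
  finally show ?thesis .
qed

definition sample_size :: "real \<Rightarrow> real \<Rightarrow> nat" where
  "sample_size y \<delta> = (if \<delta> \<ge> 1 then 0 else nat \<lceil>4 * y\<^sup>2 / \<delta>\<rceil>)"

lemma sample_size_le:
  assumes "\<delta> > 0"
  shows "real (sample_size y \<delta>) \<le> of_int \<lceil>4 * y\<^sup>2 / \<delta>\<rceil>"
proof -
  have "0 \<le> 4 * y\<^sup>2 / \<delta>"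
    using assms by simp
  then show ?thesis
    by (simp add: sample_size_def)
qed

lemma sample_size_zero: "sample_size 0 \<delta> = 0"
  by (simp add: sample_size_def)

lemma sample_size_bounds:
  assumes "0 < \<delta>" "\<delta> < 1" "y \<noteq> 0"
  shows "2 * \<bar>y\<bar> \<le> real (sample_size y \<delta>)" "8 * y\<^sup>2 / sample_size y \<delta> \<le> 2 * \<delta>"
proof -
  let ?n = "real (sample_size y \<delta>)"
  have "4 * y\<^sup>2 / \<delta> \<le> ?n"
    using assms real_nat_ceiling_ge[of "4 * y\<^sup>2 / \<delta>"] by (simp add: sample_size_def)
  then have le: "4 * y\<^sup>2 \<le> ?n * \<delta>"
    using assms by (simp add: pos_divide_le_eq)
  then have n: "?n > 0"
    using assms(3) by (cases "sample_size y \<delta> = 0") auto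
  then show "8 * y\<^sup>2 / ?n \<le> 2 * \<delta>"
    using le by (simp add: pos_divide_le_eq mult_ac)
  have "?n * \<delta> \<le> ?n * ?n"
    using assms n by (intro mult_left_mono) auto
  then have "(2 * \<bar>y\<bar>)\<^sup>2 \<le> ?n\<^sup>2"
    using le by (simp add: power2_eq_square)
  then show "2 * \<bar>y\<bar> \<le> ?n"
    by (rule power2_le_imp_le) simp
qed

lemma sampling_error_sample_size:
  fixes c :: "nat \<Rightarrow> real" and t \<delta> :: real
  assumes \<rho>: "\<And>j. j < K \<Longrightarrow> density dA (\<rho> j)" and \<sigma>: "density (dA * dB) \<sigma>" and \<delta>: "\<delta> > 0"
  defines "U \<equiv> evolution dB (ham dA K c \<rho>) t"
    and "n \<equiv> sample_size ((\<Sum>j<K. \<bar>c j\<bar>) * t) \<delta>"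
  shows "trace_norm (U * \<sigma> * adj U - protocol_output dA dB (sample_seqs K n) (sampling_prob K c)
    (sampling_channel dA dB K c t n) \<rho> \<sigma>) / 2 \<le> \<delta>"
proof -
  consider "\<delta> \<ge> 1" | "(\<Sum>j<K. \<bar>c j\<bar>) * t = 0" | "\<delta> < 1" "(\<Sum>j<K. \<bar>c j\<bar>) * t \<noteq> 0"
    by linarith
  then show ?thesis
  proof cases
    case 1
    then have "n = 0" by (simp add: n_def sample_size_def)
    then show ?thesis
      using 1 empty_sampling_error(1)[of K dA \<rho> dB \<sigma> c t] \<rho> \<sigma> by (simp add: U_def)
  next
    case 2
    then have "n = 0" by (simp only: n_def sample_size_zero)
    then show ?thesis
      using \<delta> 2 empty_sampling_error(2)[of K dA \<rho> dB \<sigma> c t] \<rho> \<sigma> by (simp add: U_def)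
  next
    case 3
    then show ?thesis
      using sampling_error[of K dA \<rho> dB \<sigma> c t n] sample_size_bounds[OF \<delta> 3] \<rho> \<sigma>
      by (simp add: U_def n_def)
  qed
qed

lemma expected_copies_le:
  fixes c :: "nat \<Rightarrow> real" and t \<delta> :: real and K :: nat
  defines "ctot \<equiv> (\<Sum>j<K. \<bar>c j\<bar>)"
  defines "n \<equiv> sample_size (ctot * t) \<delta>"
  assumes \<delta>: "\<delta> > 0" and j: "j < K"
  shows "(\<Sum>js\<in>sample_seqs K n. sampling_prob K c js * real (count_list js j)) \<le>
    4 * (\<bar>c j\<bar> * ctot * t\<^sup>2 / \<delta> + \<bar>c j\<bar> / ctot)"
proof (cases "ctot = 0")
  case True
  then have "n = 0"
    by (simp add: n_def sample_size_zero)
  then show ?thesis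
    using True by simp
next
  case False
  moreover have "ctot \<ge> 0"
    unfolding ctot_def by (rule sum_nonneg) simp
  ultimately have ctot: "ctot > 0" by simp
  have "(\<Sum>js\<in>sample_seqs K n. sampling_prob K c js * real (count_list js j)) = real n * (\<bar>c j\<bar> / ctot)"
    unfolding sampling_prob_def ctot_def using False j
    by (intro expected_count_list sum_normalized_abs) (simp_all add: ctot_def)
  also have "\<dots> \<le> (4 * (ctot * t)\<^sup>2 / \<delta> + 1) * (\<bar>c j\<bar> / ctot)"
    using sample_size_le[OF \<delta>, of "ctot * t"] ceiling_correct[of "4 * (ctot * t)\<^sup>2 / \<delta>"] ctot
    by (intro mult_right_mono) (auto simp: n_def)
  also have "\<dots> = 4 * (\<bar>c j\<bar> * ctot * t\<^sup>2 / \<delta>) + \<bar>c j\<bar> / ctot"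
    using ctot by (simp add: field_simps power2_eq_square)
  also have "\<dots> \<le> 4 * (\<bar>c j\<bar> * ctot * t\<^sup>2 / \<delta> + \<bar>c j\<bar> / ctot)"
    using ctot by (auto intro!: divide_right_mono)
  finally show ?thesis .
qed

theorem mainTheorem8:
  "\<exists>C > (0::real). \<forall>(dA::nat) (dB::nat) (K::nat) (c::nat \<Rightarrow> real) (t::real) (\<delta>::real).
     dA > 0 \<longrightarrow> dB > 0 \<longrightarrow> \<delta> > 0 \<longrightarrow>
     (let ctot = (\<Sum>j<K. \<bar>c j\<bar>) in
      \<exists>(n::nat) S p \<Phi>.
        valid_protocol dA dB K S p \<Phi> \<and>
        real n \<le> of_int \<lceil>C * ctot^2 * t^2 / \<delta>\<rceil> \<and>
        (\<forall>js \<in> S. length js \<le> n) \<and>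
        (\<forall>j<K. (\<Sum>js\<in>S. p js * real (count_list js j))
                 \<le> C * (\<bar>c j\<bar> * ctot * t^2 / \<delta> + \<bar>c j\<bar> / ctot)) \<and>
        (\<forall>\<rho> \<sigma>. (\<forall>j<K. density dA (\<rho> j)) \<longrightarrow> density (dA * dB) \<sigma> \<longrightarrow>
           (let U = kron (mexp ((- \<i> * complex_of_real t) \<cdot>\<^sub>m ham dA K c \<rho>)) (1\<^sub>m dB) in
            trace_norm (U * \<sigma> * adj U - protocol_output dA dB S p \<Phi> \<rho> \<sigma>) / 2 \<le> C * \<delta>)))"
  (is "\<exists>C > 0. \<forall>dA dB K c t \<delta>. _ \<longrightarrow> _ \<longrightarrow> _ \<longrightarrow> ?simulates C dA dB K c t \<delta>")
proof (rule exI[of _ 4], intro conjI allI impI)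
  fix dA dB K :: nat and c :: "nat \<Rightarrow> real" and t \<delta> :: real
  assume \<delta>: "\<delta> > 0"
  define n where "n = sample_size ((\<Sum>j<K. \<bar>c j\<bar>) * t) \<delta>"
  show "?simulates 4 dA dB K c t \<delta>"
    unfolding Let_def evolution_def[symmetric]
  proof (intro exI conjI ballI allI impI)
    show "valid_protocol dA dB K (sample_seqs K n) (sampling_prob K c) (sampling_channel dA dB K c t n)"
      by (rule valid_sampling_protocol) (auto simp: n_def sample_size_zero)
    show "real n \<le> of_int \<lceil>4 * (\<Sum>j<K. \<bar>c j\<bar>)\<^sup>2 * t\<^sup>2 / \<delta>\<rceil>"
      using sample_size_le[OF \<delta>, of "(\<Sum>j<K. \<bar>c j\<bar>) * t"]
      by (simp add: n_def power_mult_distrib mult.assoc)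
    show "length js \<le> n" if "js \<in> sample_seqs K n" for js
      using that by (simp add: length_n_lists_elem)
    show "(\<Sum>js\<in>sample_seqs K n. sampling_prob K c js * real (count_list js j)) \<le>
        4 * (\<bar>c j\<bar> * (\<Sum>j<K. \<bar>c j\<bar>) * t\<^sup>2 / \<delta> + \<bar>c j\<bar> / (\<Sum>j<K. \<bar>c j\<bar>))" if "j < K" for j
      unfolding n_def using \<delta> that by (rule expected_copies_le)
    show "trace_norm (evolution dB (ham dA K c \<rho>) t * \<sigma> * adj (evolution dB (ham dA K c \<rho>) t) -
        protocol_output dA dB (sample_seqs K n) (sampling_prob K c)
          (sampling_channel dA dB K c t n) \<rho> \<sigma>) / 2 \<le> 4 * \<delta>"
      if "\<forall>j<K. density dA (\<rho> j)" "density (dA * dB) \<sigma>" for \<rho> \<sigma>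
      unfolding n_def using that \<delta> by (intro order_trans[OF sampling_error_sample_size]) auto
  qed
qed simp

end
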